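(* Let $T$ be a locally finite tree all of whose vertices have valence $\geq 3$, and let $G \in \mathcal{S}$ be a compactly generated closed subgroup of $\mathrm{Aut}(T)$ which does not stabilise any proper non-empty subtree of $T$ and which satisfies Tits' independence property. Then the following conditions are equivalent. (i) Every proper open subgroup of $G$ is compact. (ii) For every vertex $v \in V(T)$, the induced action of the stabiliser $G_v$ on $E(v)$ is primitive; in particular $G$ is edge-transitive.
   Context: $V(T)$ is the vertex set of $T$, $E(T)$ its edge set, and $E(v)$ is the set of edges containing the vertex $v$. $\mathrm{Aut}(T)$ carries the permutation topology: a subgroup is open iff it contains the pointwise stabiliser of some finite subset of $T$; it is totally disconnected and locally compact. $\mathcal{S}$ denotes the class of non-discrete totally disconnected locally compact groups which are topologically simple (no closed normal subgroups other than the trivial one and the whole group). Subgroups of $\mathrm{Aut}(T)$ carry the induced topology. Tits' independence property for $G \leq \mathrm{Aut}(T)$: for every (finite or infinite) chain (path) $C$ of $T$, let $F$ be the pointwise stabiliser of $C$ in $G$; for each vertex $v$ of $T$ let $\pi(v)$ be the vertex of $C$ closest to $v$; for $c \in V(C)$ the set $\pi^{-1}(c)$ is $F$-invariant, and $F_c$ denotes the permutation group obtained by restricting the action of $F$ to $\pi^{-1}(c)$. The property requires that for every such $C$ the natural homomorphism $F \to \prod_{c \in V(C)} F_c$ is an isomorphism. A primitive action is a transitive action preserving no non-trivial equivalence relation. Edge-transitive means transitive on $E(T)$. *)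

theory Defs
  imports "HOL-Analysis.Analysis" "HOL-Algebra.Group_Action" "HOL-Algebra.Product_Groups"
    "HOL-Algebra.Generated_Groups"
begin

section \<open>Trees\<close>

text \<open>A simple graph is given by a vertex set \<open>V\<close> and a set \<open>E\<close> of two-element subsets of \<open>V\<close>.\<close>

definition simple_graph :: "'v set \<Rightarrow> 'v set set \<Rightarrow> bool" where
  "simple_graph V E \<longleftrightarrow> (\<forall>e\<in>E. e \<subseteq> V \<and> card e = 2)"

definition walk :: "'v set \<Rightarrow> 'v set set \<Rightarrow> 'v list \<Rightarrow> bool" where
  "walk V E p \<longleftrightarrow> p \<noteq> [] \<and> set p \<subseteq> V \<and> successively (\<lambda>x y. {x, y} \<in> E) p"

definition connected_graph :: "'v set \<Rightarrow> 'v set set \<Rightarrow> bool" where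
  "connected_graph V E \<longleftrightarrow> (\<forall>u\<in>V. \<forall>v\<in>V. \<exists>p. walk V E p \<and> hd p = u \<and> last p = v)"

definition cycle :: "'v set \<Rightarrow> 'v set set \<Rightarrow> 'v list \<Rightarrow> bool" where
  "cycle V E p \<longleftrightarrow> walk V E p \<and> distinct p \<and> 3 \<le> length p \<and> {last p, hd p} \<in> E"

definition tree :: "'v set \<Rightarrow> 'v set set \<Rightarrow> bool" where
  "tree V E \<longleftrightarrow> V \<noteq> {} \<and> simple_graph V E \<and> connected_graph V E \<and> (\<nexists>p. cycle V E p)"

text \<open>Subtrees are non-empty, since \<^const>\<open>tree\<close> excludes the empty graph.\<close>

definition subtree :: "'v set \<Rightarrow> 'v set set \<Rightarrow> 'v set \<Rightarrow> 'v set set \<Rightarrow> bool" where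
  "subtree V' E' V E \<longleftrightarrow> V' \<subseteq> V \<and> E' \<subseteq> E \<and> tree V' E'"

definition edges_at :: "'v set set \<Rightarrow> 'v \<Rightarrow> 'v set set" where
  "edges_at E v = {e \<in> E. v \<in> e}"

definition locally_finite :: "'v set \<Rightarrow> 'v set set \<Rightarrow> bool" where
  "locally_finite V E \<longleftrightarrow> (\<forall>v\<in>V. finite (edges_at E v))"

definition valence :: "'v set set \<Rightarrow> 'v \<Rightarrow> nat" where
  "valence E v = card (edges_at E v)"

definition gdist :: "'v set \<Rightarrow> 'v set set \<Rightarrow> 'v \<Rightarrow> 'v \<Rightarrow> nat" where
  "gdist V E u v = (LEAST n. \<exists>p. walk V E p \<and> hd p = u \<and> last p = v \<and> length p = Suc n)"


section \<open>The automorphism group and its permutation topology\<close>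

text \<open>As in \<^const>\<open>BijGroup\<close>, automorphisms are extensional functions on \<open>V\<close>.\<close>

definition Aut :: "'v set \<Rightarrow> 'v set set \<Rightarrow> ('v \<Rightarrow> 'v) monoid" where
  "Aut V E = (BijGroup V)
     \<lparr>carrier := {g \<in> Bij V. \<forall>u\<in>V. \<forall>v\<in>V. {g u, g v} \<in> E \<longleftrightarrow> {u, v} \<in> E}\<rparr>"

definition pointwise_stabiliser :: "('v \<Rightarrow> 'v) set \<Rightarrow> 'v set \<Rightarrow> ('v \<Rightarrow> 'v) set" where
  "pointwise_stabiliser G C = {g \<in> G. \<forall>x\<in>C. g x = x}"

text \<open>The group topology in which the pointwise stabilisers of finite sets of vertices form a
  basis of neighbourhoods of the identity: a set is open iff it contains, with each of its
  elements \<open>g\<close>, a coset \<open>{h. h x = g x for all x in A}\<close> for some finite \<open>A\<close>.\<close>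

definition perm_top :: "'v set \<Rightarrow> 'v set set \<Rightarrow> ('v \<Rightarrow> 'v) topology" where
  "perm_top V E = topology (\<lambda>U. U \<subseteq> carrier (Aut V E) \<and>
     (\<forall>g\<in>U. \<exists>A. finite A \<and> A \<subseteq> V \<and> {h \<in> carrier (Aut V E). \<forall>x\<in>A. h x = g x} \<subseteq> U))"


section \<open>Topological groups\<close>

definition topological_group :: "('g, 'b) monoid_scheme \<Rightarrow> 'g topology \<Rightarrow> bool" where
  "topological_group G T \<longleftrightarrow> group G \<and> topspace T = carrier G \<and>
     continuous_map (prod_topology T T) T (\<lambda>(x, y). x \<otimes>\<^bsub>G\<^esub> y) \<and>
     continuous_map T T (\<lambda>x. inv\<^bsub>G\<^esub> x)"

definition totally_disconnected_space :: "'g topology \<Rightarrow> bool" where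
  "totally_disconnected_space T \<longleftrightarrow>
     (\<forall>x\<in>topspace T. connected_component_of_set T x = {x})"

definition topologically_simple :: "('g, 'b) monoid_scheme \<Rightarrow> 'g topology \<Rightarrow> bool" where
  "topologically_simple G T \<longleftrightarrow>
     (\<forall>N. N \<lhd> G \<and> closedin T N \<longrightarrow> N = {\<one>\<^bsub>G\<^esub>} \<or> N = carrier G)"

definition class_S :: "('g, 'b) monoid_scheme \<Rightarrow> 'g topology \<Rightarrow> bool" where
  "class_S G T \<longleftrightarrow> topological_group G T \<and> T \<noteq> discrete_topology (carrier G) \<and>
     totally_disconnected_space T \<and> Hausdorff_space T \<and> locally_compact_space T \<and>
     topologically_simple G T"

definition compactly_generated :: "('g, 'b) monoid_scheme \<Rightarrow> 'g topology \<Rightarrow> bool" where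
  "compactly_generated G T \<longleftrightarrow> (\<exists>K. compactin T K \<and> generate G K = carrier G)"


section \<open>Actions\<close>

definition primitive_action ::
  "('g, 'b) monoid_scheme \<Rightarrow> 'x set \<Rightarrow> ('g \<Rightarrow> 'x \<Rightarrow> 'x) \<Rightarrow> bool" where
  "primitive_action G S \<phi> \<longleftrightarrow> transitive_action G S \<phi> \<and>
     (\<forall>r. equiv S r \<and> (\<forall>g\<in>carrier G. \<forall>x y. (x, y) \<in> r \<longrightarrow> (\<phi> g x, \<phi> g y) \<in> r)
          \<longrightarrow> r = Id_on S \<or> r = S \<times> S)"

definition edge_action :: "'v set set \<Rightarrow> ('v \<Rightarrow> 'v) \<Rightarrow> 'v set \<Rightarrow> 'v set" where
  "edge_action D = (\<lambda>g. \<lambda>e\<in>D. g ` e)"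


section \<open>Tits' independence property\<close>

text \<open>A chain is represented by its vertex set, enumerated injectively by a non-empty interval
  of integers; so it is a finite path (possibly a single vertex), a ray or a bi-infinite line.\<close>

definition chain :: "'v set \<Rightarrow> 'v set set \<Rightarrow> 'v set \<Rightarrow> bool" where
  "chain V E C \<longleftrightarrow> (\<exists>(I::int set) c. I \<noteq> {} \<and>
     (\<forall>i\<in>I. \<forall>k\<in>I. {i..k} \<subseteq> I) \<and>
     inj_on c I \<and> C = c ` I \<and> C \<subseteq> V \<and>
     (\<forall>i. i \<in> I \<and> i + 1 \<in> I \<longrightarrow> {c i, c (i + 1)} \<in> E))"

text \<open>In a tree the vertex of a chain closest to a given vertex is unique.\<close>

definition closest :: "'v set \<Rightarrow> 'v set set \<Rightarrow> 'v set \<Rightarrow> 'v \<Rightarrow> 'v" where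
  "closest V E C v = arg_min_on (\<lambda>c. gdist V E v c) C"

definition closest_fibre :: "'v set \<Rightarrow> 'v set set \<Rightarrow> 'v set \<Rightarrow> 'v \<Rightarrow> 'v set" where
  "closest_fibre V E C c = {v \<in> V. closest V E C v = c}"

definition tits_independence :: "'v set \<Rightarrow> 'v set set \<Rightarrow> ('v \<Rightarrow> 'v) set \<Rightarrow> bool" where
  "tits_independence V E G \<longleftrightarrow> (\<forall>C. chain V E C \<longrightarrow>
     (let F = pointwise_stabiliser G C;
          P = closest_fibre V E C
      in (\<lambda>g. \<lambda>c\<in>C. restrict g (P c))
           \<in> iso ((Aut V E)\<lparr>carrier := F\<rparr>)
                 (product_group C (\<lambda>c. (BijGroup (P c))\<lparr>carrier := (\<lambda>g. restrict g (P c)) ` F\<rparr>))))"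


section \<open>Basic facts\<close>

lemma openin_perm_top:
  "openin (perm_top V E) U \<longleftrightarrow> U \<subseteq> carrier (Aut V E) \<and>
     (\<forall>g\<in>U. \<exists>A. finite A \<and> A \<subseteq> V \<and> {h \<in> carrier (Aut V E). \<forall>x\<in>A. h x = g x} \<subseteq> U)"
proof -
  let ?P = "\<lambda>U. U \<subseteq> carrier (Aut V E) \<and>
     (\<forall>g\<in>U. \<exists>A. finite A \<and> A \<subseteq> V \<and> {h \<in> carrier (Aut V E). \<forall>x\<in>A. h x = g x} \<subseteq> U)"
  have "istopology ?P"
    unfolding istopology_def
  proof (intro conjI allI impI)
    fix S T assume S: "?P S" and T: "?P T"
    show "S \<inter> T \<subseteq> carrier (Aut V E)" using S by blast
    show "\<forall>g\<in>S \<inter> T. \<exists>A. finite A \<and> A \<subseteq> V \<and>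
            {h \<in> carrier (Aut V E). \<forall>x\<in>A. h x = g x} \<subseteq> S \<inter> T"
    proof
      fix g assume g: "g \<in> S \<inter> T"
      obtain A where "finite A" "A \<subseteq> V" "{h \<in> carrier (Aut V E). \<forall>x\<in>A. h x = g x} \<subseteq> S"
        using S g by blast
      moreover obtain B where "finite B" "B \<subseteq> V"
          "{h \<in> carrier (Aut V E). \<forall>x\<in>B. h x = g x} \<subseteq> T"
        using T g by blast
      ultimately show "\<exists>A. finite A \<and> A \<subseteq> V \<and>
          {h \<in> carrier (Aut V E). \<forall>x\<in>A. h x = g x} \<subseteq> S \<inter> T"
        by (intro exI[of _ "A \<union> B"]) auto
    qed
  next
    fix K assume K: "\<forall>S\<in>K. ?P S"
    show "\<Union>K \<subseteq> carrier (Aut V E)" using K by blast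
    show "\<forall>g\<in>\<Union>K. \<exists>A. finite A \<and> A \<subseteq> V \<and>
            {h \<in> carrier (Aut V E). \<forall>x\<in>A. h x = g x} \<subseteq> \<Union>K"
    proof
      fix g assume "g \<in> \<Union>K"
      then obtain S where S: "S \<in> K" "g \<in> S" by blast
      then obtain A where "finite A" "A \<subseteq> V" "{h \<in> carrier (Aut V E). \<forall>x\<in>A. h x = g x} \<subseteq> S"
        using bspec[OF K S(1)] by blast
      then show "\<exists>A. finite A \<and> A \<subseteq> V \<and> {h \<in> carrier (Aut V E). \<forall>x\<in>A. h x = g x} \<subseteq> \<Union>K"
        using S by (intro exI[of _ A]) auto
    qed
  qed
  then show ?thesis
    unfolding perm_top_def by (simp only: topology_inverse')
qed

lemma topspace_perm_top: "topspace (perm_top V E) = carrier (Aut V E)"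
proof -
  have "openin (perm_top V E) (carrier (Aut V E))"
    unfolding openin_perm_top
  proof (intro conjI ballI)
    fix g show "\<exists>A. finite A \<and> A \<subseteq> V \<and>
        {h \<in> carrier (Aut V E). \<forall>x\<in>A. h x = g x} \<subseteq> carrier (Aut V E)"
      by (intro exI[of _ "{}"]) simp
  qed simp
  then have "carrier (Aut V E) \<subseteq> topspace (perm_top V E)" by (rule openin_subset)
  moreover have "topspace (perm_top V E) \<subseteq> carrier (Aut V E)"
    using openin_topspace[of "perm_top V E"] unfolding openin_perm_top by (rule conjunct1)
  ultimately show ?thesis by (rule equalityI[rotated])
qed

lemma carrier_Aut:
  "carrier (Aut V E) = {g \<in> Bij V. \<forall>u\<in>V. \<forall>v\<in>V. {g u, g v} \<in> E \<longleftrightarrow> {u, v} \<in> E}"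
  by (simp add: Aut_def)

lemma subgroup_Aut: "subgroup (carrier (Aut V E)) (BijGroup V)"
proof (rule group.subgroupI[OF group_BijGroup])
  show "carrier (Aut V E) \<subseteq> carrier (BijGroup V)"
    by (auto simp: carrier_Aut BijGroup_def)
  have "(\<lambda>x\<in>V. x) \<in> carrier (Aut V E)"
    by (simp add: carrier_Aut id_Bij)
  then show "carrier (Aut V E) \<noteq> {}" by blast
next
  fix g assume g: "g \<in> carrier (Aut V E)"
  then have gB: "g \<in> Bij V" by (simp add: carrier_Aut)
  have bij: "bij_betw g V V" using gB by (simp add: Bij_def)
  have inv: "inv\<^bsub>BijGroup V\<^esub> g = (\<lambda>x\<in>V. inv_into V g x)"
    by (rule inv_BijGroup[OF gB])
  show "inv\<^bsub>BijGroup V\<^esub> g \<in> carrier (Aut V E)"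
    unfolding inv carrier_Aut
  proof (intro CollectI conjI ballI)
    show "(\<lambda>x\<in>V. inv_into V g x) \<in> Bij V" by (rule restrict_inv_into_Bij[OF gB])
    fix u v assume uv: "u \<in> V" "v \<in> V"
    have "inv_into V g u \<in> V" "inv_into V g v \<in> V" "g (inv_into V g u) = u" "g (inv_into V g v) = v"
      using uv bij by (auto simp: bij_betw_def inv_into_into f_inv_into_f)
    moreover have "{g a, g b} \<in> E \<longleftrightarrow> {a, b} \<in> E" if "a \<in> V" "b \<in> V" for a b
      using g that unfolding carrier_Aut by blast
    ultimately have "{u, v} \<in> E \<longleftrightarrow> {inv_into V g u, inv_into V g v} \<in> E"
      by metis
    then show "({(\<lambda>x\<in>V. inv_into V g x) u, (\<lambda>x\<in>V. inv_into V g x) v} \<in> E) = ({u, v} \<in> E)"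
      using uv by simp
  qed
next
  fix g h assume gh: "g \<in> carrier (Aut V E)" "h \<in> carrier (Aut V E)"
  then have B: "g \<in> Bij V" "h \<in> Bij V" by (auto simp: carrier_Aut)
  have "h x \<in> V" if "x \<in> V" for x
    using B that Bij_imp_funcset by blast
  then show "g \<otimes>\<^bsub>BijGroup V\<^esub> h \<in> carrier (Aut V E)"
    using gh B by (auto simp: BijGroup_def carrier_Aut compose_Bij compose_eq)
qed

lemma group_Aut: "group (Aut V E)"
  using group.subgroup_imp_group[OF group_BijGroup subgroup_Aut]
  by (simp add: Aut_def)

lemma mult_Aut:
  assumes "g \<in> carrier (Aut V E)" "h \<in> carrier (Aut V E)"
  shows "g \<otimes>\<^bsub>Aut V E\<^esub> h = compose V g h"
  using assms by (simp add: Aut_def BijGroup_def)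

lemma one_Aut: "\<one>\<^bsub>Aut V E\<^esub> = (\<lambda>x\<in>V. x)"
  by (simp add: Aut_def BijGroup_def)

lemma openin_perm_top_subgroup_iff:
  assumes H: "subgroup H (Aut V E)"
  shows "openin (perm_top V E) H \<longleftrightarrow>
    (\<exists>A. finite A \<and> A \<subseteq> V \<and> pointwise_stabiliser (carrier (Aut V E)) A \<subseteq> H)"
proof
  assume "openin (perm_top V E) H"
  moreover have "(\<lambda>x\<in>V. x) \<in> H" using subgroup.one_closed[OF H] by (simp add: one_Aut)
  ultimately obtain A where A: "finite A" "A \<subseteq> V"
      "{h \<in> carrier (Aut V E). \<forall>x\<in>A. h x = (\<lambda>x\<in>V. x) x} \<subseteq> H"
    unfolding openin_perm_top by blast
  have "pointwise_stabiliser (carrier (Aut V E)) A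
      \<subseteq> {h \<in> carrier (Aut V E). \<forall>x\<in>A. h x = (\<lambda>x\<in>V. x) x}"
    using A(2) by (auto simp: pointwise_stabiliser_def)
  then have "pointwise_stabiliser (carrier (Aut V E)) A \<subseteq> H"
    using A(3) by (rule subset_trans)
  with A show "\<exists>A. finite A \<and> A \<subseteq> V \<and> pointwise_stabiliser (carrier (Aut V E)) A \<subseteq> H" by blast
next
  interpret group "Aut V E" by (rule group_Aut)
  assume "\<exists>A. finite A \<and> A \<subseteq> V \<and> pointwise_stabiliser (carrier (Aut V E)) A \<subseteq> H"
  then obtain A where A: "finite A" "A \<subseteq> V"
      "pointwise_stabiliser (carrier (Aut V E)) A \<subseteq> H" by blast
  have "{h \<in> carrier (Aut V E). \<forall>x\<in>A. h x = g x} \<subseteq> H" if g: "g \<in> H" for g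
  proof
    fix h assume "h \<in> {h \<in> carrier (Aut V E). \<forall>x\<in>A. h x = g x}"
    then have h: "h \<in> carrier (Aut V E)" "\<And>x. x \<in> A \<Longrightarrow> h x = g x" by auto
    have gc: "g \<in> carrier (Aut V E)" using subgroup.mem_carrier[OF H g] .
    let ?k = "inv\<^bsub>Aut V E\<^esub> g \<otimes>\<^bsub>Aut V E\<^esub> h"
    have ic: "inv\<^bsub>Aut V E\<^esub> g \<in> carrier (Aut V E)" using gc by simp
    have "?k x = x" if x: "x \<in> A" for x
    proof -
      have xV: "x \<in> V" using x A by blast
      have "?k x = (inv\<^bsub>Aut V E\<^esub> g) (g x)"
        using x xV h by (simp add: mult_Aut[OF ic h(1)] compose_eq)
      also have "\<dots> = (inv\<^bsub>Aut V E\<^esub> g \<otimes>\<^bsub>Aut V E\<^esub> g) x"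
        using xV by (simp add: mult_Aut[OF ic gc] compose_eq)
      also have "\<dots> = x" using gc xV by (simp add: one_Aut)
      finally show ?thesis .
    qed
    then have "?k \<in> H" using A(3) h(1) ic by (auto simp: pointwise_stabiliser_def)
    then have "g \<otimes>\<^bsub>Aut V E\<^esub> ?k \<in> H" using subgroup.m_closed[OF H g] by blast
    then show "h \<in> H" using gc h(1) by (simp add: m_assoc[symmetric])
  qed
  moreover have "H \<subseteq> carrier (Aut V E)" using subgroup.subset[OF H] .
  ultimately show "openin (perm_top V E) H"
    unfolding openin_perm_top using A(1,2) by blast
qed

lemma group_action_edges:
  assumes H: "subgroup H (Aut V E)" and E: "simple_graph V E" and D: "D \<subseteq> E"
    and inv: "\<And>g e. g \<in> H \<Longrightarrow> e \<in> D \<Longrightarrow> g ` e \<in> D"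
  shows "group_action ((Aut V E)\<lparr>carrier := H\<rparr>) D (edge_action D)"
proof -
  interpret group "Aut V E" by (rule group_Aut)
  have Hc: "g \<in> carrier (Aut V E)" if "g \<in> H" for g
    using subgroup.mem_carrier[OF H that] .
  have sub: "e \<subseteq> V" if "e \<in> D" for e using that D E by (auto simp: simple_graph_def)
  have comp: "edge_action D (g \<otimes>\<^bsub>Aut V E\<^esub> h) = compose D (edge_action D g) (edge_action D h)"
    if gh: "g \<in> H" "h \<in> H" for g h
  proof
    fix e
    have "(compose V g h) ` e = g ` h ` e" if "e \<in> D"
      using sub[OF that] by (force simp: compose_def image_iff)
    then show "edge_action D (g \<otimes>\<^bsub>Aut V E\<^esub> h) e = compose D (edge_action D g) (edge_action D h) e"
      using inv[OF gh(2)] by (simp add: edge_action_def mult_Aut Hc gh compose_def)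
  qed
  have one: "edge_action D \<one>\<^bsub>Aut V E\<^esub> = (\<lambda>e\<in>D. e)"
  proof
    fix e show "edge_action D \<one>\<^bsub>Aut V E\<^esub> e = (\<lambda>e\<in>D. e) e"
      using sub by (force simp: edge_action_def one_Aut image_iff)
  qed
  have bij: "edge_action D g \<in> Bij D" if g: "g \<in> H" for g
  proof -
    have ig: "inv\<^bsub>Aut V E\<^esub> g \<in> H" using subgroup.m_inv_closed[OF H g] .
    let ?i = "inv\<^bsub>Aut V E\<^esub> g"
    have 1: "compose D (edge_action D ?i) (edge_action D g) = (\<lambda>e\<in>D. e)"
      using comp[OF ig g] Hc[OF g] one by simp
    have 2: "compose D (edge_action D g) (edge_action D ?i) = (\<lambda>e\<in>D. e)"
      using comp[OF g ig] Hc[OF g] one by simp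
    have "bij_betw (edge_action D g) D D"
    proof (rule bij_betw_byWitness[where f' = "edge_action D ?i"])
      show "\<forall>e\<in>D. edge_action D ?i (edge_action D g e) = e"
        using 1 by (metis compose_eq restrict_apply')
      show "\<forall>e\<in>D. edge_action D g (edge_action D ?i e) = e"
        using 2 by (metis compose_eq restrict_apply')
      show "edge_action D g ` D \<subseteq> D" "edge_action D ?i ` D \<subseteq> D"
        using inv g ig by (auto simp: edge_action_def)
    qed
    then show ?thesis by (simp add: Bij_def edge_action_def)
  qed
  have "group ((Aut V E)\<lparr>carrier := H\<rparr>)" by (rule subgroup_imp_group[OF H])
  moreover have "edge_action D \<in> hom ((Aut V E)\<lparr>carrier := H\<rparr>) (BijGroup D)"
    using bij comp by (auto simp: hom_def BijGroup_def)
  ultimately show ?thesis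
    by (simp add: group_action_def group_hom_def group_hom_axioms_def group_BijGroup)
qed

end

theory Submission
  imports Defs
begin

text \<open>
  By topological simplicity, a subgroup of \<open>G\<close> containing the stabilisers of all vertices of one
  orbit is \<open>G\<close>, because its normal core is open and non-trivial; hence every
  \<open>G\<close>-invariant set of edges yields a \<open>G\<close>-invariant \<open>2\<close>-colouring of the vertices which changes
  exactly along these edges.

  (i) implies (ii). By compact generation and minimality \<open>G\<close> is cocompact, so a block \<open>Y\<close> of vertices
  whose (open) stabiliser is compact is finite. If \<open>G\<^sub>v\<close> is intransitive on \<open>E(v)\<close>, delete the \<open>G\<close>-orbit
  of an edge at \<open>v\<close> such that at least two edges at \<open>v\<close> remain: the component of \<open>v\<close> has no leaves, so it
  is an infinite block, which the colouring prevents from being all of \<open>V\<close>. If \<open>G\<^sub>v\<close> is transitive and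
  preserves an equivalence relation on \<open>E(v)\<close>, its \<open>G\<close>-translates generate a relation on the vertices of
  the other type whose classes are infinite blocks.

  (ii) implies (i). Let \<open>H\<close> be open and contain the fixator of a finite set \<open>F\<close>. If \<open>H\<close> has unbounded
  orbits, some \<open>h \<in> H\<close> moves \<open>F\<close> so far that three consecutive edges separate \<open>F\<close> from \<open>h F\<close>. By
  the independence property \<open>H\<close> contains the stabilisers of these edges. Edge stabilisers are maximal
  in vertex stabilisers and those of distinct edges at a vertex differ, so \<open>H\<close> contains the stabilisers
  of two adjacent vertices, then of all vertices, and \<open>H = G\<close>. Otherwise \<open>H\<close> is closed with finite
  orbits, hence compact.
\<close>

section \<open>Distances in trees\<close>

text \<open>Adjacency becomes a relation, so that connectivity is \<open>rtrancl\<close> and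
  distance is a relation power. Since the edge set is the only parameter, edges can be deleted
  freely.\<close>

definition arcs :: "'v set set \<Rightarrow> 'v rel" where
  "arcs E = {(x, y). {x, y} \<in> E}"

lemma arcs_iff [simp]: "(x, y) \<in> arcs E \<longleftrightarrow> {x, y} \<in> E"
  by (simp add: arcs_def)

lemma sym_arcs: "sym (arcs E)"
  by (auto simp: sym_def insert_commute)

lemma arcs_rtrancl_sym: "(x, y) \<in> (arcs E)\<^sup>* \<Longrightarrow> (y, x) \<in> (arcs E)\<^sup>*"
  using sym_rtrancl[OF sym_arcs] by (rule symD)

lemma arcs_mono: "E \<subseteq> E' \<Longrightarrow> (x, y) \<in> (arcs E)\<^sup>* \<Longrightarrow> (x, y) \<in> (arcs E')\<^sup>*"
  by (erule rtrancl_mono[THEN subsetD, rotated]) auto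

lemma walk_imp_relpow:
  "walk V E p \<Longrightarrow> (hd p, last p) \<in> arcs E ^^ (length p - 1)"
proof (induction p rule: induct_list012)
  case (3 x y zs)
  then have "(hd (y # zs), last (y # zs)) \<in> arcs E ^^ (length (y # zs) - 1)"
    by (auto simp: walk_def)
  moreover have "(x, y) \<in> arcs E" using 3 by (auto simp: walk_def)
  ultimately have "(x, last (y # zs)) \<in> arcs E ^^ Suc (length zs)"
    by (intro relpow_Suc_I2) auto
  then show ?case by (simp del: relpow.simps)
qed (auto simp: walk_def)

lemma relpow_imp_walk:
  assumes "\<forall>e\<in>E. e \<subseteq> V"
  shows "x \<in> V \<Longrightarrow> (x, y) \<in> arcs E ^^ n \<Longrightarrow>
    \<exists>p. walk V E p \<and> hd p = x \<and> last p = y \<and> length p = Suc n"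
proof (induction n arbitrary: x)
  case 0
  then show ?case by (intro exI[of _ "[x]"]) (auto simp: walk_def)
next
  case (Suc n)
  then obtain z where z: "{x, z} \<in> E" "(z, y) \<in> arcs E ^^ n"
    by (auto elim: relpow_Suc_E2 simp del: relpow.simps)
  then have "z \<in> V" using assms by blast
  from Suc.IH[OF this z(2)] obtain p where
    p: "walk V E p" "hd p = z" "last p = y" "length p = Suc n" by blast
  then have "walk V E (x # p)"
    using z Suc.prems by (cases p) (auto simp: walk_def)
  then show ?case using p by (intro exI[of _ "x # p"]) (auto simp: walk_def)
qed

text \<open>Loops are erased while the walk grows at its front: if the new first vertex already
  occurs, only the suffix starting there is kept.\<close>

lemma rtrancl_imp_distinct_walk:
  assumes "\<forall>e\<in>E. e \<subseteq> V" "y \<in> V" "(x, y) \<in> (arcs E)\<^sup>*"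
  shows "\<exists>p. walk V E p \<and> distinct p \<and> hd p = x \<and> last p = y"
  using assms(3)
proof (induction rule: converse_rtrancl_induct)
  case base
  then show ?case using assms by (intro exI[of _ "[y]"]) (auto simp: walk_def)
next
  case (step x z)
  then obtain p where p: "walk V E p" "distinct p" "hd p = z" "last p = y" by blast
  show ?case
  proof (cases "x \<in> set p")
    case True
    then obtain ys zs where s: "p = ys @ x # zs" by (meson split_list)
    have "walk V E (x # zs)"
      using p(1) unfolding s by (auto simp: walk_def successively_append_iff)
    then show ?thesis using p s by (intro exI[of _ "x # zs"]) auto
  next
    case False
    have "x \<in> V" using step(1) assms by auto
    then have "walk V E (x # p)" using step(1) p by (cases p) (auto simp: walk_def)
    then show ?thesis using p False by (intro exI[of _ "x # p"]) (auto simp: walk_def)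
  qed
qed

locale tree_graph =
  fixes V :: "'v set" and E :: "'v set set"
  assumes tree: "tree V E"
begin

abbreviation d :: "'v \<Rightarrow> 'v \<Rightarrow> nat" where "d \<equiv> gdist V E"

lemma V_nonempty: "V \<noteq> {}" using tree by (simp add: tree_def)

lemma edge_sub: "e \<in> E \<Longrightarrow> e \<subseteq> V"
  using tree by (auto simp: tree_def simple_graph_def)

lemma adj_in: "{x, y} \<in> E \<Longrightarrow> x \<in> V \<and> y \<in> V"
  using edge_sub[of "{x, y}"] by simp

lemma adj_neq: "{x, y} \<in> E \<Longrightarrow> x \<noteq> y"
  using tree by (auto simp: tree_def simple_graph_def)

lemma edge_ends:
  assumes "e \<in> E"
  obtains x y where "e = {x, y}"
proof -
  have "card e = 2" using assms tree by (auto simp: tree_def simple_graph_def)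
  then show ?thesis using that by (auto simp: card_2_iff)
qed

lemma edge_at_end:
  assumes "e \<in> E" "v \<in> e"
  obtains u where "e = {v, u}"
  using edge_ends[OF assms(1)] assms(2) by (metis insert_commute insertE singletonD)

lemma conn: "x \<in> V \<Longrightarrow> y \<in> V \<Longrightarrow> (x, y) \<in> (arcs E)\<^sup>*"
  using tree walk_imp_relpow unfolding tree_def connected_graph_def
  by (metis relpow_imp_rtrancl)

text \<open>A simple walk from \<open>x\<close> to \<open>y\<close> avoiding this edge would be
  closed by it to a cycle. Acyclicity enters the distance lemmas in this form.\<close>

lemma bridge:
  assumes "{x, y} \<in> E"
  shows "(x, y) \<notin> (arcs (E - {{x, y}}))\<^sup>*"
proof
  assume "(x, y) \<in> (arcs (E - {{x, y}}))\<^sup>*"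
  moreover have "\<forall>e\<in>E - {{x, y}}. e \<subseteq> V" using edge_sub by simp
  ultimately obtain p where p: "walk V (E - {{x, y}}) p" "distinct p" "hd p = x" "last p = y"
    using rtrancl_imp_distinct_walk[of "E - {{x, y}}" V y x] adj_in[OF assms] by blast
  have w: "walk V E p"
    using p(1) unfolding walk_def by (auto intro: successively_mono)
  have "x \<noteq> y" by (rule adj_neq[OF assms])
  \<comment> \<open>A walk on two vertices would traverse the deleted edge itself.\<close>
  have "3 \<le> length p"
  proof (cases p rule: remdups_adj.cases)
    case (3 a b zs)
    then show ?thesis using p \<open>x \<noteq> y\<close> by (cases zs) (simp_all add: walk_def)
  qed (use p \<open>x \<noteq> y\<close> in \<open>simp_all add: walk_def\<close>)
  then have "cycle V E p"
    using w p assms by (auto simp: cycle_def insert_commute)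
  then show False using tree by (auto simp: tree_def)
qed

lemma gdist_relpow:
  "x \<in> V \<Longrightarrow> d x y = (LEAST n. (x, y) \<in> arcs E ^^ n)"
proof -
  assume x: "x \<in> V"
  have "(\<exists>p. walk V E p \<and> hd p = x \<and> last p = y \<and> length p = Suc n) \<longleftrightarrow> (x, y) \<in> arcs E ^^ n" for n
  proof
    assume "\<exists>p. walk V E p \<and> hd p = x \<and> last p = y \<and> length p = Suc n"
    then show "(x, y) \<in> arcs E ^^ n" using walk_imp_relpow[of V E] by fastforce
  next
    assume "(x, y) \<in> arcs E ^^ n"
    then show "\<exists>p. walk V E p \<and> hd p = x \<and> last p = y \<and> length p = Suc n"
      using relpow_imp_walk[OF _ x] edge_sub by blast
  qed
  then show ?thesis by (simp add: gdist_def)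
qed

lemma d_le: "x \<in> V \<Longrightarrow> (x, y) \<in> arcs E ^^ n \<Longrightarrow> d x y \<le> n"
  by (simp add: gdist_relpow Least_le)

lemma d_relpow: "x \<in> V \<Longrightarrow> y \<in> V \<Longrightarrow> (x, y) \<in> arcs E ^^ d x y"
  using conn[of x y] by (auto simp: gdist_relpow rtrancl_power intro: LeastI)

lemma relpow_arcs_sym: "(x, y) \<in> arcs F ^^ n \<Longrightarrow> (y, x) \<in> arcs F ^^ n"
proof (induction n arbitrary: y)
  case (Suc n)
  then obtain z where "(x, z) \<in> arcs F ^^ n" "{y, z} \<in> F" by (auto simp: insert_commute)
  with Suc.IH show ?case by (intro relpow_Suc_I2) auto
qed auto

lemma d_sym: "x \<in> V \<Longrightarrow> y \<in> V \<Longrightarrow> d x y = d y x"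
  using d_le d_relpow relpow_arcs_sym by (metis order_antisym)

lemma d_self [simp]: "x \<in> V \<Longrightarrow> d x x = 0"
  using d_le[of x x 0] by simp

lemma d_eq_0: "x \<in> V \<Longrightarrow> y \<in> V \<Longrightarrow> d x y = 0 \<longleftrightarrow> x = y"
  using d_relpow[of x y] by fastforce

lemma d_triangle: "x \<in> V \<Longrightarrow> y \<in> V \<Longrightarrow> z \<in> V \<Longrightarrow> d x z \<le> d x y + d y z"
  by (rule d_le) (auto simp: relpow_add intro: d_relpow)

lemma d_adj [simp]: "{x, y} \<in> E \<Longrightarrow> d x y = 1"
proof -
  assume e: "{x, y} \<in> E"
  have "d x y \<le> 1" using d_le[of x y 1] adj_in[OF e] e by simp
  moreover have "d x y \<noteq> 0" using d_eq_0[of x y] adj_in[OF e] adj_neq[OF e] by simp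
  ultimately show ?thesis by simp
qed

lemma d_step: "{x, y} \<in> E \<Longrightarrow> r \<in> V \<Longrightarrow> d r y \<le> Suc (d r x)"
  using d_triangle[of r x y] adj_in[of x y] by simp

lemma closer_exists:
  assumes "r \<in> V" "x \<in> V" "x \<noteq> r"
  obtains y where "{x, y} \<in> E" "d r x = Suc (d r y)"
proof -
  obtain n where n: "d r x = Suc n" using d_eq_0[of r x] assms by (cases "d r x") auto
  then obtain y where y: "(r, y) \<in> arcs E ^^ n" "{x, y} \<in> E"
    using d_relpow[OF assms(1,2)] by (auto simp: insert_commute)
  have "d r y \<le> n" using d_le[OF assms(1) y(1)] .
  moreover have "d r x \<le> Suc (d r y)" using d_step[of y x r] y assms by (simp add: insert_commute)
  ultimately show ?thesis using that[OF y(2)] n by simp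
qed

text \<open>A geodesic from \<open>r\<close> to \<open>x\<close> meets the sphere through \<open>x\<close> only in \<open>x\<close>.\<close>

lemma geodesic:
  assumes "r \<in> V"
  shows "x \<in> V \<Longrightarrow> (r, x) \<in> (arcs {e \<in> E. \<forall>z\<in>e. z = x \<or> d r z < d r x})\<^sup>*"
proof (induction "d r x" arbitrary: x)
  case 0
  then show ?case using d_eq_0 assms by simp
next
  case (Suc n)
  then obtain y where y: "{x, y} \<in> E" "d r x = Suc (d r y)"
    using closer_exists[of r x] assms d_self by (metis nat.distinct(1))
  have "(r, y) \<in> (arcs {e \<in> E. \<forall>z\<in>e. z = y \<or> d r z < d r y})\<^sup>*"
    using Suc y adj_in by auto
  then have "(r, y) \<in> (arcs {e \<in> E. \<forall>z\<in>e. z = x \<or> d r z < d r x})\<^sup>*"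
    by (rule arcs_mono[rotated]) (use y in auto)
  moreover have "(y, x) \<in> arcs {e \<in> E. \<forall>z\<in>e. z = x \<or> d r z < d r x}"
    using y by (simp add: insert_commute)
  ultimately show ?case by (rule rtrancl_into_rtrancl)
qed

text \<open>Were both ends at the same distance, the geodesics from \<open>r\<close> to them would
  avoid the edge, against \<open>bridge\<close>.\<close>

lemma adj_dist:
  assumes "{x, y} \<in> E" "r \<in> V"
  shows "d r y = Suc (d r x) \<or> d r x = Suc (d r y)"
proof -
  have "d r x \<noteq> d r y"
  proof
    assume eq: "d r x = d r y"
    note xy = adj_in[OF assms(1)] adj_neq[OF assms(1)]
    have "(r, x) \<in> (arcs (E - {{x, y}}))\<^sup>*"
      by (rule arcs_mono[OF _ geodesic]) (use assms xy eq in auto)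
    moreover have "(r, y) \<in> (arcs (E - {{x, y}}))\<^sup>*"
      by (rule arcs_mono[OF _ geodesic]) (use assms xy eq in auto)
    ultimately have "(x, y) \<in> (arcs (E - {{x, y}}))\<^sup>*"
      using arcs_rtrancl_sym rtrancl_trans by metis
    with bridge[OF assms(1)] show False by simp
  qed
  moreover have "d r x \<le> Suc (d r y)"
    using d_step[of y x r] assms by (simp add: insert_commute)
  ultimately show ?thesis using d_step[OF assms] by linarith
qed

text \<open>Two different closer neighbours would give a detour from \<open>y\<close> to
  \<open>r\<close>, on to \<open>y'\<close> and then to \<open>x\<close>, which avoids the edge
  \<open>{x, y}\<close>.\<close>

lemma closer_unique:
  assumes "r \<in> V" "{x, y} \<in> E" "{x, y'} \<in> E" "d r y < d r x" "d r y' < d r x"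
  shows "y = y'"
proof (rule ccontr)
  assume ne: "y \<noteq> y'"
  note xy = adj_in[OF assms(2)] adj_in[OF assms(3)] adj_neq[OF assms(2)] adj_neq[OF assms(3)]
  have "(r, y) \<in> (arcs (E - {{x, y}}))\<^sup>*"
    by (rule arcs_mono[OF _ geodesic]) (use assms xy in auto)
  moreover have "(r, y') \<in> (arcs (E - {{x, y}}))\<^sup>*"
    by (rule arcs_mono[OF _ geodesic]) (use assms xy in auto)
  moreover have "(y', x) \<in> (arcs (E - {{x, y}}))\<^sup>*"
    using assms ne by (intro r_into_rtrancl) (auto simp: insert_commute doubleton_eq_iff)
  ultimately have "(x, y) \<in> (arcs (E - {{x, y}}))\<^sup>*"
    using arcs_rtrancl_sym rtrancl_trans by metis
  with bridge[OF assms(2)] show False by simp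
qed

text \<open>The comparison \<open>d z x < d z y\<close> encodes the half-tree of \<open>x\<close>
  cut off by the edge. Geodesics from \<open>z\<close> to \<open>x\<close> and from
  \<open>z'\<close> to \<open>y\<close> avoid that edge, so any other edge between the half-trees
  would contradict \<open>bridge\<close>.\<close>

lemma crossing:
  assumes e: "{x, y} \<in> E" and f: "{z, z'} \<in> E"
    and z: "d z x < d z y" and z': "\<not> d z' x < d z' y"
  shows "z = x \<and> z' = y"
proof -
  note V = adj_in[OF e] adj_in[OF f]
  have 1: "d z y = Suc (d z x)" using adj_dist[OF e, of z] V z by auto
  have 2: "d z' x = Suc (d z' y)" using adj_dist[OF e, of z'] V z' by auto
  have 3: "d z x = Suc (d z' x) \<or> d z' x = Suc (d z x)"
    using adj_dist[OF f, of x] V d_sym by auto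
  have 4: "d z y = Suc (d z' y) \<or> d z' y = Suc (d z y)"
    using adj_dist[OF f, of y] V d_sym by auto
  have k: "d z' y = d z x" using 1 2 3 4 by linarith
  have zx: "(z, x) \<in> (arcs (E - {{x, y}}))\<^sup>*"
    by (rule arcs_mono[OF _ geodesic]) (use V 1 adj_neq[OF e] in auto)
  have zy: "(z', y) \<in> (arcs (E - {{x, y}}))\<^sup>*"
    by (rule arcs_mono[OF _ geodesic]) (use V 2 adj_neq[OF e] in auto)
  have "{z, z'} = {x, y}"
  proof (rule ccontr)
    assume "{z, z'} \<noteq> {x, y}"
    then have "(z, z') \<in> (arcs (E - {{x, y}}))\<^sup>*"
      using f by (intro r_into_rtrancl) simp
    then have "(x, y) \<in> (arcs (E - {{x, y}}))\<^sup>*"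
      using arcs_rtrancl_sym[OF zx] zy by (meson rtrancl_trans)
    with bridge[OF e] show False by simp
  qed
  moreover have "z \<noteq> y" using 1 V by auto
  ultimately show ?thesis by (auto simp: doubleton_eq_iff)
qed

text \<open>By \<open>crossing\<close> every walk between the half-trees uses the edge
  \<open>{x, y}\<close>; the induction follows a walk from \<open>v\<close> to \<open>z\<close> up
  to its first crossing.\<close>

lemma dist_across:
  assumes e: "{x, y} \<in> E" and "v \<in> V" "z \<in> V" "d v x < d v y" "\<not> d z x < d z y"
  shows "d v x + 1 + d y z \<le> d v z"
proof -
  have "v \<in> V \<Longrightarrow> d v x < d v y \<Longrightarrow> (v, z) \<in> arcs E ^^ n \<Longrightarrow> d v x + 1 + d y z \<le> n" for v n
  proof (induction n arbitrary: v)
    case 0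
    then show ?case using assms by simp
  next
    case (Suc n)
    then obtain w where w: "{v, w} \<in> E" "(w, z) \<in> arcs E ^^ n"
      by (auto elim: relpow_Suc_E2 simp del: relpow.simps)
    have wV: "w \<in> V" using adj_in[OF w(1)] by simp
    show ?case
    proof (cases "d w x < d w y")
      case True
      then have "d w x + 1 + d y z \<le> n" using Suc.IH wV w by blast
      moreover have "d v x \<le> Suc (d w x)"
        using d_triangle[of v w x] w adj_in[OF w(1)] adj_in[OF e] by simp
      ultimately show ?thesis by simp
    next
      case False
      then have "v = x \<and> w = y" using crossing[OF e w(1)] Suc.prems by simp
      then show ?thesis using d_le[of y z n] w wV Suc.prems by simp
    qed
  qed
  then show ?thesis using assms d_relpow by blast
qed

lemma tree_induct [consumes 2, case_names root step]:
  assumes "r \<in> V" "x \<in> V"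
    and "P r"
    and "\<And>x y. {x, y} \<in> E \<Longrightarrow> d r y = Suc (d r x) \<Longrightarrow> P x \<Longrightarrow> P y"
  shows "P x"
  using assms(2)
proof (induction "d r x" arbitrary: x)
  case 0
  then show ?case using d_eq_0 assms by simp
next
  case (Suc n)
  then obtain y where "{x, y} \<in> E" "d r x = Suc (d r y)"
    using closer_exists[of r x] assms(1) d_self by (metis nat.distinct(1))
  then show ?case using Suc assms(4)[of y x] adj_in by (auto simp: insert_commute)
qed

text \<open>By \<open>closer_unique\<close> each vertex other than the root has a single parent, so
  values can be handed down from the root.\<close>

lemma tree_recursion:
  assumes r: "r \<in> V"
  obtains h :: "'v \<Rightarrow> 'b" where "h r = a"
    "\<And>x y. {x, y} \<in> E \<Longrightarrow> d r y = Suc (d r x) \<Longrightarrow> h y = F x y (h x)"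
proof -
  define par where "par y = (SOME x. {x, y} \<in> E \<and> d r y = Suc (d r x))" for y
  \<comment> \<open>The values of \<open>hh n\<close> are meaningful on the sphere of radius
    \<open>n\<close> about \<open>r\<close> only, hence \<open>h\<close> evaluates \<open>hh\<close>
    at level \<open>d r y\<close>.\<close>
  define hh where "hh = rec_nat (\<lambda>_. a) (\<lambda>_ f y. F (par y) y (f (par y)))"
  define h where "h y = hh (d r y) y" for y
  have "h y = F x y (h x)" if "{x, y} \<in> E" "d r y = Suc (d r x)" for x y
  proof -
    have "{par y, y} \<in> E \<and> d r y = Suc (d r (par y))"
      unfolding par_def by (rule someI[of _ x]) (use that in simp)
    then have "par y = x"
      by (intro closer_unique[OF r, of y]) (use that in \<open>auto simp: insert_commute\<close>)
    then show ?thesis unfolding h_def that(2) by (simp add: hh_def)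
  qed
  moreover have "h r = a" using r by (simp add: h_def hh_def)
  ultimately show ?thesis using that by blast
qed

definition nbrs :: "'v \<Rightarrow> 'v set" where "nbrs v = {u. {v, u} \<in> E}"

lemma nbrs_iff [simp]: "u \<in> nbrs v \<longleftrightarrow> {v, u} \<in> E" by (simp add: nbrs_def)

lemma edges_at_eq: "edges_at E v = (\<lambda>u. {v, u}) ` nbrs v"
proof (intro equalityI subsetI)
  fix e assume e: "e \<in> edges_at E v"
  then obtain u where "e = {v, u}" by (auto simp: edges_at_def elim: edge_at_end)
  with e show "e \<in> (\<lambda>u. {v, u}) ` nbrs v" by (auto simp: edges_at_def)
qed (auto simp: edges_at_def)

lemma inj_edges_at: "inj (\<lambda>u. {v, u})"
  by (auto simp: inj_def doubleton_eq_iff)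

lemma card_nbrs: "card (nbrs v) = valence E v"
  by (simp add: valence_def edges_at_eq card_image inj_on_subset[OF inj_edges_at])

lemma farther_of_two:
  assumes "r \<in> V" "{x, y} \<in> E" "{x, y'} \<in> E" "y \<noteq> y'"
  shows "d r x < d r y \<or> d r x < d r y'"
  using closer_unique[OF assms(1-3)] adj_dist[OF assms(2,1)] adj_dist[OF assms(3,1)] assms(4) by auto

end

locale loc_finite_tree = tree_graph +
  assumes lf: "locally_finite V E"
begin

lemma finite_nbrs: "v \<in> V \<Longrightarrow> finite (nbrs v)"
  using lf inj_on_subset[OF inj_edges_at, of "nbrs v" v]
  by (auto simp: locally_finite_def edges_at_eq dest: finite_imageD)

lemma finite_ball: "v \<in> V \<Longrightarrow> finite {x \<in> V. d v x \<le> n}"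
proof (induction n)
  case 0
  then have "{x \<in> V. d v x \<le> 0} = {v}" using d_eq_0 by auto
  then show ?case by simp
next
  case (Suc n)
  have "{x \<in> V. d v x \<le> Suc n} \<subseteq> insert v (\<Union>y\<in>{x \<in> V. d v x \<le> n}. nbrs y)"
  proof
    fix x assume x: "x \<in> {x \<in> V. d v x \<le> Suc n}"
    show "x \<in> insert v (\<Union>y\<in>{x \<in> V. d v x \<le> n}. nbrs y)"
    proof (cases "x = v")
      case False
      then obtain y where "{x, y} \<in> E" "d v x = Suc (d v y)"
        using closer_exists[of v x] x Suc.prems by auto
      then show ?thesis using x adj_in[of x y] by (auto simp: insert_commute)
    qed simp
  qed
  moreover have "finite (insert v (\<Union>y\<in>{x \<in> V. d v x \<le> n}. nbrs y))"
    using Suc finite_nbrs by auto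
  ultimately show ?case by (rule finite_subset)
qed

end

section \<open>Groups of tree automorphisms\<close>

context tree_graph
begin

sublocale A: group "Aut V E" by (rule group_Aut)

lemma aut_bij: "g \<in> carrier (Aut V E) \<Longrightarrow> bij_betw g V V"
  by (simp add: carrier_Aut Bij_def)

lemma aut_in: "g \<in> carrier (Aut V E) \<Longrightarrow> x \<in> V \<Longrightarrow> g x \<in> V"
  by (metis aut_bij bij_betwE)

lemma aut_inj: "g \<in> carrier (Aut V E) \<Longrightarrow> x \<in> V \<Longrightarrow> y \<in> V \<Longrightarrow> g x = g y \<longleftrightarrow> x = y"
  by (meson aut_bij bij_betw_imp_inj_on inj_on_eq_iff)

lemma aut_adj:
  "g \<in> carrier (Aut V E) \<Longrightarrow> x \<in> V \<Longrightarrow> y \<in> V \<Longrightarrow> {g x, g y} \<in> E \<longleftrightarrow> {x, y} \<in> E"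
  by (simp add: carrier_Aut)

lemma aut_adjI: "g \<in> carrier (Aut V E) \<Longrightarrow> {x, y} \<in> E \<Longrightarrow> {g x, g y} \<in> E"
  by (metis aut_adj adj_in)

lemma mult_apply:
  "g \<in> carrier (Aut V E) \<Longrightarrow> h \<in> carrier (Aut V E) \<Longrightarrow> x \<in> V \<Longrightarrow> (g \<otimes>\<^bsub>Aut V E\<^esub> h) x = g (h x)"
  by (simp add: mult_Aut compose_eq)

lemma one_apply: "x \<in> V \<Longrightarrow> \<one>\<^bsub>Aut V E\<^esub> x = x"
  by (simp add: one_Aut)

lemma inv_apply:
  assumes "g \<in> carrier (Aut V E)" "x \<in> V"
  shows "(inv\<^bsub>Aut V E\<^esub> g) (g x) = x" "g ((inv\<^bsub>Aut V E\<^esub> g) x) = x"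
  using mult_apply[of "inv\<^bsub>Aut V E\<^esub> g" g x] mult_apply[of g "inv\<^bsub>Aut V E\<^esub> g" x] assms
  by (simp_all add: one_apply)

lemma d_aut_le:
  assumes g: "g \<in> carrier (Aut V E)" and x: "x \<in> V" and y: "y \<in> V"
  shows "d (g x) (g y) \<le> d x y"
proof -
  have "y \<in> V \<Longrightarrow> (x, y) \<in> arcs E ^^ n \<Longrightarrow> (g x, g y) \<in> arcs E ^^ n" for n y
  proof (induction n arbitrary: y)
    case (Suc n)
    then obtain z where z: "(x, z) \<in> arcs E ^^ n" "{z, y} \<in> E" by auto
    then have "(g x, g z) \<in> arcs E ^^ n" using Suc.IH adj_in by blast
    then show ?case using aut_adjI[OF g z(2)] by (auto intro: relpow_Suc_I)
  qed auto
  then show ?thesis using d_le aut_in[OF g x] d_relpow[OF x y] y by blast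
qed

lemma d_aut:
  assumes g: "g \<in> carrier (Aut V E)" and x: "x \<in> V" and y: "y \<in> V"
  shows "d (g x) (g y) = d x y"
  using d_aut_le[OF assms] d_aut_le[of "inv\<^bsub>Aut V E\<^esub> g" "g x" "g y"] assms aut_in[OF g]
  by (simp add: inv_apply)

lemma coset_fixes:
  assumes "g \<in> carrier (Aut V E)" "h \<in> carrier (Aut V E)" "x \<in> V" "g x = h x"
  shows "(inv\<^bsub>Aut V E\<^esub> h \<otimes>\<^bsub>Aut V E\<^esub> g) x = x"
  using assms by (simp add: mult_apply inv_apply)

end

section \<open>Subgroups of the automorphism group and their topology\<close>

locale tree_action = tree_graph +
  fixes G :: "('a \<Rightarrow> 'a) set"
  assumes G: "subgroup G (Aut V E)"
begin

lemma Gc: "g \<in> G \<Longrightarrow> g \<in> carrier (Aut V E)"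
  by (rule subgroup.mem_carrier[OF G])

lemmas G_mult = subgroup.m_closed[OF G]
lemmas G_inv = subgroup.m_inv_closed[OF G]
lemmas G_one = subgroup.one_closed[OF G]
lemmas G_in = aut_in[OF Gc]
lemmas G_adjI = aut_adjI[OF Gc]
lemmas G_adj = aut_adj[OF Gc]
lemmas G_inj = aut_inj[OF Gc]
lemmas G_d = d_aut[OF Gc]

lemma G_mult_apply: "g \<in> G \<Longrightarrow> h \<in> G \<Longrightarrow> x \<in> V \<Longrightarrow> (g \<otimes>\<^bsub>Aut V E\<^esub> h) x = g (h x)"
  by (simp add: mult_apply Gc)

lemmas G_inv_apply = inv_apply[OF Gc]

lemma inv_image_eq: "g \<in> G \<Longrightarrow> x \<in> V \<Longrightarrow> g x = y \<Longrightarrow> (inv\<^bsub>Aut V E\<^esub> g) y = x"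
  using G_inv_apply by blast

lemma openin_sub_iff:
  "openin (subtopology (perm_top V E) G) U \<longleftrightarrow> U \<subseteq> G \<and>
    (\<forall>g\<in>U. \<exists>F. finite F \<and> F \<subseteq> V \<and> {h \<in> G. \<forall>x\<in>F. h x = g x} \<subseteq> U)"
  (is "?L \<longleftrightarrow> ?R")
proof
  assume ?L
  then obtain T where T: "openin (perm_top V E) T" "U = T \<inter> G" by (auto simp: openin_subtopology)
  show ?R
  proof (intro conjI ballI)
    fix g assume "g \<in> U"
    then obtain F where "finite F" "F \<subseteq> V" "{h \<in> carrier (Aut V E). \<forall>x\<in>F. h x = g x} \<subseteq> T"
      using T unfolding openin_perm_top by blast
    then show "\<exists>F. finite F \<and> F \<subseteq> V \<and> {h \<in> G. \<forall>x\<in>F. h x = g x} \<subseteq> U"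
      using T(2) Gc by (intro exI[of _ F]) auto
  qed (use T in blast)
next
  assume R: ?R
  \<comment> \<open>\<open>T\<close> is the union of those basic open sets of the full automorphism
    group whose centre and whose trace on \<open>G\<close> lie in \<open>U\<close>.\<close>
  define T where "T = {h \<in> carrier (Aut V E). \<exists>g\<in>U. \<exists>F. finite F \<and> F \<subseteq> V \<and>
    {k \<in> G. \<forall>x\<in>F. k x = g x} \<subseteq> U \<and> (\<forall>x\<in>F. h x = g x)}"
  have "openin (perm_top V E) T"
    unfolding openin_perm_top
  proof (intro conjI ballI)
    fix h assume "h \<in> T"
    then obtain g F where gF: "g \<in> U" "finite F" "F \<subseteq> V"
      "{k \<in> G. \<forall>x\<in>F. k x = g x} \<subseteq> U" "\<forall>x\<in>F. h x = g x" unfolding T_def by blast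
    have "{k \<in> carrier (Aut V E). \<forall>x\<in>F. k x = h x} \<subseteq> T"
    proof
      fix k assume "k \<in> {k \<in> carrier (Aut V E). \<forall>x\<in>F. k x = h x}"
      then have "k \<in> carrier (Aut V E)" "\<forall>x\<in>F. k x = g x" using gF(5) by simp_all
      then show "k \<in> T" unfolding T_def using gF(1-4) by blast
    qed
    then show "\<exists>F. finite F \<and> F \<subseteq> V \<and> {k \<in> carrier (Aut V E). \<forall>x\<in>F. k x = h x} \<subseteq> T"
      using gF by blast
  qed (auto simp: T_def)
  moreover have "U = T \<inter> G"
  proof
    show "U \<subseteq> T \<inter> G"
    proof
      fix g assume g: "g \<in> U"
      then obtain F where "finite F" "F \<subseteq> V" "{h \<in> G. \<forall>x\<in>F. h x = g x} \<subseteq> U"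
        using R by blast
      moreover have "g \<in> G" using g R by blast
      moreover then have "g \<in> carrier (Aut V E)" by (rule Gc)
      ultimately show "g \<in> T \<inter> G" unfolding T_def using g by blast
    qed
  qed (auto simp: T_def)
  ultimately show ?L by (auto simp: openin_subtopology)
qed

lemma openin_subgroupI:
  assumes H: "subgroup H (Aut V E)" "H \<subseteq> G" and F: "finite F" "F \<subseteq> V"
    and pt: "\<And>g. g \<in> G \<Longrightarrow> (\<forall>x\<in>F. g x = x) \<Longrightarrow> g \<in> H"
  shows "openin (subtopology (perm_top V E) G) H"
  unfolding openin_sub_iff
proof (intro conjI ballI exI[of _ F])
  fix g assume g: "g \<in> H"
  show "{h \<in> G. \<forall>x\<in>F. h x = g x} \<subseteq> H"
  proof
    fix h assume h: "h \<in> {h \<in> G. \<forall>x\<in>F. h x = g x}"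
    have gG: "g \<in> G" using g H by blast
    have "\<forall>x\<in>F. (inv\<^bsub>Aut V E\<^esub> g \<otimes>\<^bsub>Aut V E\<^esub> h) x = x"
      using h gG F coset_fixes Gc by blast
    then have "inv\<^bsub>Aut V E\<^esub> g \<otimes>\<^bsub>Aut V E\<^esub> h \<in> H" using pt h gG G_mult G_inv by blast
    then have "g \<otimes>\<^bsub>Aut V E\<^esub> (inv\<^bsub>Aut V E\<^esub> g \<otimes>\<^bsub>Aut V E\<^esub> h) \<in> H"
      using subgroup.m_closed[OF H(1) g] by blast
    then show "h \<in> H" using h gG Gc by (simp add: A.m_assoc[symmetric])
  qed
qed (use assms in auto)

lemma open_subgroup_stab:
  assumes H: "subgroup H (Aut V E)" and o: "openin (subtopology (perm_top V E) G) H"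
  obtains F where "finite F" "F \<subseteq> V" "\<And>g. g \<in> G \<Longrightarrow> (\<forall>x\<in>F. g x = x) \<Longrightarrow> g \<in> H"
proof -
  have "\<one>\<^bsub>Aut V E\<^esub> \<in> H" by (rule subgroup.one_closed[OF H])
  then obtain F where F: "finite F" "F \<subseteq> V" "{h \<in> G. \<forall>x\<in>F. h x = \<one>\<^bsub>Aut V E\<^esub> x} \<subseteq> H"
    using o unfolding openin_sub_iff by blast
  have "g \<in> H" if "g \<in> G" "\<forall>x\<in>F. g x = x" for g
  proof -
    have "\<forall>x\<in>F. g x = \<one>\<^bsub>Aut V E\<^esub> x" using F(2) that(2) one_apply by (simp add: subset_iff)
    then show ?thesis using F(3) that by blast
  qed
  then show ?thesis using that F by blast
qed

text \<open>The complement is open: outside \<open>G\<close> because \<open>G\<close> is closed,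
  inside \<open>G\<close> because a coset of the fixator of \<open>F\<close> that meets
  \<open>H\<close> is contained in \<open>H\<close>.\<close>

lemma closed_open_subgroup:
  assumes H: "subgroup H (Aut V E)" "H \<subseteq> G" and o: "openin (subtopology (perm_top V E) G) H"
    and c: "closedin (perm_top V E) G"
  shows "closedin (perm_top V E) H"
proof -
  obtain F where F: "finite F" "F \<subseteq> V" "\<And>g. g \<in> G \<Longrightarrow> (\<forall>x\<in>F. g x = x) \<Longrightarrow> g \<in> H"
    using open_subgroup_stab[OF H(1) o] by blast
  have "openin (perm_top V E) (carrier (Aut V E) - H)"
    unfolding openin_perm_top
  proof (intro conjI ballI)
    fix f assume f: "f \<in> carrier (Aut V E) - H"
    show "\<exists>B. finite B \<and> B \<subseteq> V \<and> {h \<in> carrier (Aut V E). \<forall>x\<in>B. h x = f x} \<subseteq> carrier (Aut V E) - H"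
    proof (cases "f \<in> G")
      case False
      then have "f \<in> carrier (Aut V E) - G" using f by simp
      moreover have "openin (perm_top V E) (carrier (Aut V E) - G)"
        using c by (simp add: closedin_def topspace_perm_top)
      ultimately obtain B where "finite B" "B \<subseteq> V"
        "{h \<in> carrier (Aut V E). \<forall>x\<in>B. h x = f x} \<subseteq> carrier (Aut V E) - G"
        unfolding openin_perm_top by blast
      then show ?thesis using H(2) by blast
    next
      case True
      have "h \<notin> H" if h: "h \<in> carrier (Aut V E)" "\<forall>x\<in>F. h x = f x" for h
      proof
        assume hH: "h \<in> H"
        then have hG: "h \<in> G" using H by blast
        have "\<forall>x\<in>F. (inv\<^bsub>Aut V E\<^esub> h \<otimes>\<^bsub>Aut V E\<^esub> f) x = x"
          using h f F(2) coset_fixes[of f h] by auto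
        then have "inv\<^bsub>Aut V E\<^esub> h \<otimes>\<^bsub>Aut V E\<^esub> f \<in> H" using F(3) True hG G_mult G_inv by blast
        then have "h \<otimes>\<^bsub>Aut V E\<^esub> (inv\<^bsub>Aut V E\<^esub> h \<otimes>\<^bsub>Aut V E\<^esub> f) \<in> H"
          using subgroup.m_closed[OF H(1) hH] by blast
        then show False using h f by (simp add: A.m_assoc[symmetric])
      qed
      then show ?thesis using F(1,2) by (intro exI[of _ F]) auto
    qed
  qed auto
  moreover have "H \<subseteq> carrier (Aut V E)" by (rule subgroup.subset[OF H(1)])
  ultimately show ?thesis by (simp add: closedin_def topspace_perm_top)
qed

end

section \<open>Compactness and finite orbits\<close>

context tree_graph
begin

text \<open>The automorphisms with a prescribed value at \<open>x\<close> form an open set, so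
  finitely many values suffice to cover \<open>K\<close>.\<close>

lemma compact_imp_finite_orbit:
  assumes K: "compactin (perm_top V E) K" and x: "x \<in> V"
  shows "finite ((\<lambda>g. g x) ` K)"
proof -
  define U where "U y = {g \<in> carrier (Aut V E). g x = y}" for y
  have Kc: "K \<subseteq> carrier (Aut V E)" using compactin_subset_topspace[OF K] by (simp add: topspace_perm_top)
  have "\<forall>u\<in>range U. openin (perm_top V E) u"
    unfolding openin_perm_top using x by (auto simp: U_def intro!: exI[of _ "{x}"])
  moreover have "K \<subseteq> \<Union>(range U)" using Kc by (auto simp: U_def)
  ultimately have "\<exists>\<F>. finite \<F> \<and> \<F> \<subseteq> range U \<and> K \<subseteq> \<Union>\<F>"
    using K[unfolded compactin_def, THEN conjunct2, rule_format, of "range U"] by auto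
  then obtain \<F> where \<F>: "finite \<F>" "\<F> \<subseteq> range U" "K \<subseteq> \<Union>\<F>" by blast
  obtain Y where Y: "finite Y" "\<F> = U ` Y"
    using finite_subset_image[OF \<F>(1,2)] by blast
  have "(\<lambda>g. g x) ` K \<subseteq> Y" using \<F>(3) Y(2) by (auto simp: U_def)
  then show ?thesis using Y(1) finite_subset by blast
qed

text \<open>By Tychonoff's theorem: a limit of elements of \<open>H\<close> in the product of the (finite) orbits is
  again bijective, because it permutes every orbit injectively.\<close>

lemma finite_orbits_imp_compact:
  assumes H: "subgroup H (Aut V E)" and c: "closedin (perm_top V E) H"
    and fin: "\<And>x. x \<in> V \<Longrightarrow> finite ((\<lambda>g. g x) ` H)"
  shows "compactin (perm_top V E) H"
proof -
  define B where "B x = (\<lambda>g. g x) ` H" for x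
  define P where "P = product_topology (\<lambda>x. discrete_topology (B x)) V"
  have Hc: "h \<in> carrier (Aut V E)" if "h \<in> H" for h using subgroup.mem_carrier[OF H that] .
  have tP: "topspace P = PiE V B" by (simp add: P_def)
  have HP: "H \<subseteq> topspace P"
  proof
    fix h assume h: "h \<in> H"
    then have "h \<in> extensional V" using Hc by (auto simp: carrier_Aut Bij_def)
    then show "h \<in> topspace P" using h by (auto simp: tP B_def PiE_def)
  qed
  have comp: "compact_space P"
    unfolding P_def compact_space_product_topology
    using fin by (simp add: compact_space_discrete_topology B_def)
  have nbhd: "openin P {f' \<in> PiE V B. \<forall>x\<in>F. f' x = f x}"
    if f: "f \<in> PiE V B" and F: "finite F" "F \<subseteq> V" for f F
  proof -
    define X where "X i = (if i \<in> F then {f i} else B i)" for i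
    have "openin P (PiE V X)"
      unfolding P_def
    proof (rule product_topology_basis)
      show "openin (discrete_topology (B i)) (X i)" for i
        using f F by (auto simp: X_def)
      have "{i. X i \<noteq> topspace (discrete_topology (B i))} \<subseteq> F" by (auto simp: X_def)
      then show "finite {i. X i \<noteq> topspace (discrete_topology (B i))}" using F(1) finite_subset by blast
    qed
    moreover have "PiE V X = {f' \<in> PiE V B. \<forall>x\<in>F. f' x = f x}"
    proof -
      have "PiE V X = PiE V (\<lambda>i. {y \<in> B i. i \<in> F \<longrightarrow> y = f i})"
        using f by (intro PiE_cong) (auto simp: X_def PiE_iff)
      then show ?thesis using F by (auto simp: PiE_iff extensional_def)
    qed
    ultimately show ?thesis by simp
  qed
  have lim: "f \<in> H" if f: "f \<in> PiE V B"
    and agree: "\<And>F. finite F \<Longrightarrow> F \<subseteq> V \<Longrightarrow> \<exists>h\<in>H. \<forall>x\<in>F. h x = f x" for f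
  proof -
    have inj: "inj_on f V"
    proof (rule inj_onI)
      fix x y assume xy: "x \<in> V" "y \<in> V" "f x = f y"
      obtain h where "h \<in> H" "h x = f x" "h y = f y" using agree[of "{x, y}"] xy by auto
      then show "x = y" using xy Hc aut_inj by metis
    qed
    have BV: "B y \<subseteq> V" if "y \<in> V" for y using that Hc aut_in by (auto simp: B_def)
    \<comment> \<open>At each point of the orbit the limit agrees with an element of
      \<open>H\<close>, so it maps the orbit into itself; finiteness turns injectivity into
      surjectivity.\<close>
    have perm: "f ` B y = B y" if y: "y \<in> V" for y
    proof (rule endo_inj_surj)
      show "finite (B y)" using fin[OF y] by (simp add: B_def)
      show "inj_on f (B y)" using inj BV[OF y] inj_on_subset by blast
      show "f ` B y \<subseteq> B y"
      proof
        fix z assume "z \<in> f ` B y"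
        then obtain h where h: "h \<in> H" "z = f (h y)" by (auto simp: B_def)
        have hy: "h y \<in> V" using h Hc aut_in y by blast
        then obtain k where k: "k \<in> H" "k (h y) = z" using agree[of "{h y}"] h by auto
        then have "z = (k \<otimes>\<^bsub>Aut V E\<^esub> h) y" using mult_apply Hc h y by simp
        then show "z \<in> B y" using subgroup.m_closed[OF H k(1) h(1)] by (simp add: B_def)
      qed
    qed
    have "f ` V = V"
    proof
      show "f ` V \<subseteq> V" using f BV by (auto simp: PiE_iff)
      show "V \<subseteq> f ` V"
      proof
        fix y assume y: "y \<in> V"
        have "y \<in> B y" unfolding B_def using subgroup.one_closed[OF H] one_apply[OF y] by (metis image_eqI)
        then show "y \<in> f ` V" using perm[OF y] BV[OF y] by blast
      qed
    qed
    then have "f \<in> Bij V" using f inj by (auto simp: Bij_def bij_betw_def PiE_def)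
    moreover have "{f u, f v} \<in> E \<longleftrightarrow> {u, v} \<in> E" if uv: "u \<in> V" "v \<in> V" for u v
    proof -
      obtain h where "h \<in> H" "h u = f u" "h v = f v" using agree[of "{u, v}"] uv by auto
      then show ?thesis using aut_adj[OF Hc] uv by metis
    qed
    ultimately have fA: "f \<in> carrier (Aut V E)" by (simp add: carrier_Aut)
    show "f \<in> H"
    proof (rule ccontr)
      assume "f \<notin> H"
      moreover have "openin (perm_top V E) (carrier (Aut V E) - H)"
        using c by (simp add: closedin_def topspace_perm_top)
      ultimately obtain F where F: "finite F" "F \<subseteq> V"
        "{h \<in> carrier (Aut V E). \<forall>x\<in>F. h x = f x} \<subseteq> carrier (Aut V E) - H"
        using fA unfolding openin_perm_top by blast
      then show False using agree[OF F(1,2)] Hc by blast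
    qed
  qed
  have "openin P (topspace P - H)"
  proof (subst openin_subopen, intro ballI)
    fix f assume f: "f \<in> topspace P - H"
    then obtain F where F: "finite F" "F \<subseteq> V" "\<not> (\<exists>h\<in>H. \<forall>x\<in>F. h x = f x)"
      using lim[of f] unfolding tP by blast
    show "\<exists>T. openin P T \<and> f \<in> T \<and> T \<subseteq> topspace P - H"
      using nbhd[OF _ F(1,2), of f] f F(3)
      by (intro exI[of _ "{f' \<in> PiE V B. \<forall>x\<in>F. f' x = f x}"]) (auto simp: tP)
  qed
  then have "closedin P H" using HP by (simp add: closedin_def)
  then have "compactin P H" using comp closedin_compact_space by blast
  then have "compactin (subtopology P H) H" by (simp add: compactin_subtopology)
  \<comment> \<open>Agreement on a finite set of vertices is an open condition in the product, so
    the identity on \<open>H\<close> is continuous into the permutation topology and carries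
    compactness over.\<close>
  moreover have "continuous_map (subtopology P H) (perm_top V E) (\<lambda>f. f)"
    unfolding continuous_map
  proof (intro conjI allI impI)
    show "(\<lambda>f. f) ` topspace (subtopology P H) \<subseteq> topspace (perm_top V E)"
      using Hc by (auto simp: topspace_perm_top)
    fix U assume U: "openin (perm_top V E) U"
    have "\<exists>T. openin P T \<and> g \<in> T \<and> T \<inter> H \<subseteq> U" if g: "g \<in> H \<inter> U" for g
    proof -
      obtain F where F: "finite F" "F \<subseteq> V" "{h \<in> carrier (Aut V E). \<forall>x\<in>F. h x = g x} \<subseteq> U"
        using U g unfolding openin_perm_top by blast
      show ?thesis
        using nbhd[OF _ F(1,2), of g] g F(3) HP Hc
        by (intro exI[of _ "{f' \<in> PiE V B. \<forall>x\<in>F. f' x = g x}"]) (auto simp: tP)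
    qed
    then obtain T where T: "\<And>g. g \<in> H \<inter> U \<Longrightarrow> openin P (T g) \<and> g \<in> T g \<and> T g \<inter> H \<subseteq> U"
      by metis
    have "openin P (\<Union>(T ` (H \<inter> U)))" using T by blast
    moreover have "{x \<in> topspace (subtopology P H). x \<in> U} = \<Union>(T ` (H \<inter> U)) \<inter> H"
      using T HP by auto
    ultimately show "openin (subtopology P H) {x \<in> topspace (subtopology P H). x \<in> U}"
      unfolding openin_subtopology by blast
  qed
  ultimately have "compactin (perm_top V E) ((\<lambda>f. f) ` H)" by (rule image_compactin)
  then show ?thesis by simp
qed

end

section \<open>Topological simplicity\<close>

locale simple_tree_action = tree_action +
  assumes simple: "topologically_simple ((Aut V E)\<lparr>carrier := G\<rparr>) (subtopology (perm_top V E) G)"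
    and nondiscrete: "subtopology (perm_top V E) G \<noteq> discrete_topology G"
begin

text \<open>The normal core of \<open>M\<close> contains the open subgroup \<open>G\<^bsub>w\<^esub>\<close>, hence it is open and closed.\<close>

lemma subgroup_containing_stabilisers:
  assumes M: "subgroup M (Aut V E)" "M \<subseteq> G" and w: "w \<in> V"
    and stab: "\<And>k g. k \<in> G \<Longrightarrow> g \<in> G \<Longrightarrow> g (k w) = k w \<Longrightarrow> g \<in> M"
  shows "M = G"
proof -
  define N where "N = {g \<in> G. \<forall>k\<in>G. k \<otimes>\<^bsub>Aut V E\<^esub> g \<otimes>\<^bsub>Aut V E\<^esub> inv\<^bsub>Aut V E\<^esub> k \<in> M}"
  note simps = A.m_assoc A.inv_mult_group Gc
  have sN: "subgroup N (Aut V E)"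
  proof (rule A.subgroupI)
    show "N \<subseteq> carrier (Aut V E)" using Gc by (auto simp: N_def)
    have "\<one>\<^bsub>Aut V E\<^esub> \<in> N"
      using G_one subgroup.one_closed[OF M(1)] by (simp add: N_def Gc)
    then show "N \<noteq> {}" by blast
    fix g assume g: "g \<in> N"
    then have gG: "g \<in> G" by (simp add: N_def)
    have "k \<otimes>\<^bsub>Aut V E\<^esub> inv\<^bsub>Aut V E\<^esub> g \<otimes>\<^bsub>Aut V E\<^esub> inv\<^bsub>Aut V E\<^esub> k \<in> M" if k: "k \<in> G" for k
    proof -
      have "inv\<^bsub>Aut V E\<^esub> (k \<otimes>\<^bsub>Aut V E\<^esub> g \<otimes>\<^bsub>Aut V E\<^esub> inv\<^bsub>Aut V E\<^esub> k) \<in> M"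
        using g k subgroup.m_inv_closed[OF M(1)] by (simp add: N_def)
      then show ?thesis using k gG by (simp add: simps)
    qed
    then show "inv\<^bsub>Aut V E\<^esub> g \<in> N" using gG G_inv by (simp add: N_def)
    fix h assume h: "h \<in> N"
    then have hG: "h \<in> G" by (simp add: N_def)
    have "k \<otimes>\<^bsub>Aut V E\<^esub> (g \<otimes>\<^bsub>Aut V E\<^esub> h) \<otimes>\<^bsub>Aut V E\<^esub> inv\<^bsub>Aut V E\<^esub> k \<in> M" if k: "k \<in> G" for k
    proof -
      have "(k \<otimes>\<^bsub>Aut V E\<^esub> g \<otimes>\<^bsub>Aut V E\<^esub> inv\<^bsub>Aut V E\<^esub> k) \<otimes>\<^bsub>Aut V E\<^esub>
          (k \<otimes>\<^bsub>Aut V E\<^esub> h \<otimes>\<^bsub>Aut V E\<^esub> inv\<^bsub>Aut V E\<^esub> k) \<in> M"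
        using g h k subgroup.m_closed[OF M(1)] by (simp add: N_def)
      moreover have "inv\<^bsub>Aut V E\<^esub> k \<otimes>\<^bsub>Aut V E\<^esub> (k \<otimes>\<^bsub>Aut V E\<^esub> x) = x" if "x \<in> carrier (Aut V E)" for x
        using k that by (simp add: A.m_assoc[symmetric] Gc)
      ultimately show ?thesis using k gG hG by (simp add: simps)
    qed
    then show "g \<otimes>\<^bsub>Aut V E\<^esub> h \<in> N" using gG hG G_mult by (simp add: N_def)
  qed
  have NG: "N \<subseteq> G" by (auto simp: N_def)
  \<comment> \<open>Conjugation by \<open>k\<close> carries the stabiliser of \<open>w\<close> to
    that of \<open>k w\<close>; this is why \<open>stab\<close> ranges over the whole orbit of
    \<open>w\<close>.\<close>
  have stabN: "g \<in> N" if g: "g \<in> G" "g w = w" for g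
    unfolding N_def
  proof (intro CollectI conjI ballI)
    fix k assume k: "k \<in> G"
    let ?c = "k \<otimes>\<^bsub>Aut V E\<^esub> g \<otimes>\<^bsub>Aut V E\<^esub> inv\<^bsub>Aut V E\<^esub> k"
    have "?c (k w) = k w"
      using g k w by (simp add: G_mult_apply G_mult G_inv G_inv_apply G_in)
    moreover have "?c \<in> G" using g k by (intro G_mult G_inv)
    ultimately show "?c \<in> M" by (intro stab[OF k])
  qed (use g in simp)
  interpret G': group "(Aut V E)\<lparr>carrier := G\<rparr>" by (rule A.subgroup_imp_group[OF G])
  have "N \<lhd> (Aut V E)\<lparr>carrier := G\<rparr>"
    unfolding G'.normal_inv_iff
  proof (intro conjI ballI)
    show "subgroup N ((Aut V E)\<lparr>carrier := G\<rparr>)" by (rule A.subgroup_incl[OF sN G NG])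
    fix x h assume "x \<in> carrier ((Aut V E)\<lparr>carrier := G\<rparr>)" and h: "h \<in> N"
    then have x: "x \<in> G" by simp
    have hG: "h \<in> G" using h NG by blast
    have "x \<otimes>\<^bsub>Aut V E\<^esub> h \<otimes>\<^bsub>Aut V E\<^esub> inv\<^bsub>Aut V E\<^esub> x \<in> N"
      unfolding N_def
    proof (intro CollectI conjI ballI)
      fix k assume k: "k \<in> G"
      have "(k \<otimes>\<^bsub>Aut V E\<^esub> x) \<otimes>\<^bsub>Aut V E\<^esub> h \<otimes>\<^bsub>Aut V E\<^esub> inv\<^bsub>Aut V E\<^esub> (k \<otimes>\<^bsub>Aut V E\<^esub> x) \<in> M"
        using h G_mult[OF k x] by (simp add: N_def)
      then show "k \<otimes>\<^bsub>Aut V E\<^esub> (x \<otimes>\<^bsub>Aut V E\<^esub> h \<otimes>\<^bsub>Aut V E\<^esub> inv\<^bsub>Aut V E\<^esub> x) \<otimes>\<^bsub>Aut V E\<^esub> inv\<^bsub>Aut V E\<^esub> k \<in> M"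
        using k x hG by (simp add: simps)
    qed (use x hG G_mult G_inv in simp)
    then show "x \<otimes>\<^bsub>(Aut V E)\<lparr>carrier := G\<rparr>\<^esub> h \<otimes>\<^bsub>(Aut V E)\<lparr>carrier := G\<rparr>\<^esub>
        inv\<^bsub>(Aut V E)\<lparr>carrier := G\<rparr>\<^esub> x \<in> N"
      using A.m_inv_consistent[OF G x] by simp
  qed
  moreover have "closedin (subtopology (perm_top V E) G) N"
  proof -
    have "openin (subtopology (perm_top V E) G) (G - N)"
      unfolding openin_sub_iff
    proof (intro conjI ballI exI[of _ "{w}"])
      fix g assume g: "g \<in> G - N"
      show "{h \<in> G. \<forall>x\<in>{w}. h x = g x} \<subseteq> G - N"
      proof safe
        fix h assume h: "h \<in> G" "\<forall>x\<in>{w}. h x = g x" "h \<in> N"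
        have "inv\<^bsub>Aut V E\<^esub> h \<otimes>\<^bsub>Aut V E\<^esub> g \<in> N"
          using stabN h g G_mult G_inv coset_fixes[of g h w] w Gc by simp
        then have "h \<otimes>\<^bsub>Aut V E\<^esub> (inv\<^bsub>Aut V E\<^esub> h \<otimes>\<^bsub>Aut V E\<^esub> g) \<in> N"
          using subgroup.m_closed[OF sN h(3)] by blast
        then show False using h g Gc by (simp add: A.m_assoc[symmetric])
      qed
    qed (use w in auto)
    moreover have "topspace (subtopology (perm_top V E) G) = G"
      using subgroup.subset[OF G] by (auto simp: topspace_perm_top)
    ultimately show ?thesis using NG by (simp add: closedin_def)
  qed
  ultimately consider "N = {\<one>\<^bsub>Aut V E\<^esub>}" | "N = G"
    using simple unfolding topologically_simple_def by fastforce
  then show ?thesis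
  proof cases
    case 1
    \<comment> \<open>A trivial core makes the stabiliser of \<open>w\<close> trivial. Elements of
      \<open>G\<close> are then determined by their value at \<open>w\<close>, and the topology is
      discrete.\<close>
    have "openin (subtopology (perm_top V E) G) U" if U: "U \<subseteq> G" for U
      unfolding openin_sub_iff
    proof (intro conjI ballI exI[of _ "{w}"])
      fix g assume "g \<in> U"
      then have g: "g \<in> G" using U by blast
      have "h = g" if h: "h \<in> G" "h w = g w" for h
      proof -
        have "inv\<^bsub>Aut V E\<^esub> g \<otimes>\<^bsub>Aut V E\<^esub> h = \<one>\<^bsub>Aut V E\<^esub>"
          using stabN[of "inv\<^bsub>Aut V E\<^esub> g \<otimes>\<^bsub>Aut V E\<^esub> h"] 1 h g w G_mult G_inv
            coset_fixes[of h g w] Gc by auto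
        then show ?thesis using g h Gc by (metis A.inv_equality A.inv_inv A.inv_closed)
      qed
      then show "{h \<in> G. \<forall>x\<in>{w}. h x = g x} \<subseteq> U" using \<open>g \<in> U\<close> by auto
    qed (use w U in auto)
    then have "subtopology (perm_top V E) G = discrete_topology G"
      unfolding topology_eq openin_discrete_topology using openin_sub_iff by blast
    then show ?thesis using nondiscrete by blast
  next
    case 2
    have "g \<in> M" if "g \<in> G" for g
    proof -
      have "\<one>\<^bsub>Aut V E\<^esub> \<otimes>\<^bsub>Aut V E\<^esub> g \<otimes>\<^bsub>Aut V E\<^esub> inv\<^bsub>Aut V E\<^esub> \<one>\<^bsub>Aut V E\<^esub> \<in> M"
        using that 2 G_one unfolding N_def by blast
      then show ?thesis using that Gc by simp
    qed
    then show ?thesis using M(2) by blast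
  qed
qed

end

section \<open>Local actions, colourings and cocompactness\<close>

context tree_action
begin

lemma G_subgroupI:
  assumes "M \<subseteq> G" "\<one>\<^bsub>Aut V E\<^esub> \<in> M"
    and "\<And>g. g \<in> M \<Longrightarrow> inv\<^bsub>Aut V E\<^esub> g \<in> M"
    and "\<And>g h. g \<in> M \<Longrightarrow> h \<in> M \<Longrightarrow> g \<otimes>\<^bsub>Aut V E\<^esub> h \<in> M"
  shows "subgroup M (Aut V E)"
  using assms Gc by (intro A.subgroupI) auto

lemma edge_image:
  assumes "g \<in> G" "e \<in> E"
  shows "g ` e \<in> E"
proof -
  obtain x y where "e = {x, y}" using edge_ends[OF assms(2)] .
  then show ?thesis using G_adjI[OF assms(1), of x y] assms(2) by simp
qed

lemma G_arcs:
  assumes "(x, y) \<in> (arcs F)\<^sup>*" and F: "\<And>e. e \<in> F \<Longrightarrow> g ` e \<in> F"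
  shows "(g x, g y) \<in> (arcs F)\<^sup>*"
  using assms(1)
proof (induction rule: rtrancl_induct)
  case (step y z)
  have "(g y, g z) \<in> arcs F" using F[of "{y, z}"] step(2) by simp
  with step.IH show ?case by (rule rtrancl_into_rtrancl)
qed simp

lemma edge_set_invariant:
  assumes Q: "\<And>g e. g \<in> G \<Longrightarrow> e \<in> Q \<Longrightarrow> g ` e \<in> Q" and g: "g \<in> G" "x \<in> V" "y \<in> V"
  shows "{g x, g y} \<in> Q \<longleftrightarrow> {x, y} \<in> Q"
proof
  assume "{g x, g y} \<in> Q"
  from Q[OF G_inv[OF g(1)] this] show "{x, y} \<in> Q" using g by (simp add: G_inv_apply)
qed (use Q[OF g(1), of "{x, y}"] in simp)

lemma stab_subgroup: "v \<in> V \<Longrightarrow> subgroup {g \<in> G. g v = v} (Aut V E)"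
  by (rule G_subgroupI)
    (auto simp: G_one one_apply G_inv inv_image_eq G_mult G_mult_apply)

text \<open>Neighbours of \<open>v\<close> stand for the edges at \<open>v\<close>, through the
  equivariant bijection from \<open>a\<close> to \<open>{v, a}\<close>.\<close>

definition locally_transitive :: "'a \<Rightarrow> bool" where
  "locally_transitive v \<longleftrightarrow> (\<forall>a\<in>nbrs v. \<forall>b\<in>nbrs v. \<exists>g\<in>G. g v = v \<and> g a = b)"

definition locally_primitive :: "'a \<Rightarrow> bool" where
  "locally_primitive v \<longleftrightarrow> locally_transitive v \<and>
    (\<forall>r. equiv (nbrs v) r \<and> (\<forall>g\<in>G. g v = v \<longrightarrow> (\<forall>a b. (a, b) \<in> r \<longrightarrow> (g a, g b) \<in> r)) \<longrightarrow>
      r = Id_on (nbrs v) \<or> r = nbrs v \<times> nbrs v)"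

lemma edges_action:
  assumes "g v = v" "a \<in> nbrs v"
  shows "edge_action (edges_at E v) g {v, a} = {v, g a}"
  using assms by (auto simp: edge_action_def edges_at_def)

lemma nbrs_image: "g \<in> G \<Longrightarrow> g v = v \<Longrightarrow> a \<in> nbrs v \<Longrightarrow> g a \<in> nbrs v"
  using G_adjI[of g v a] by simp

lemma transitive_action_iff:
  assumes v: "v \<in> V"
  shows "transitive_action ((Aut V E)\<lparr>carrier := {g \<in> G. g v = v}\<rparr>)
    (edges_at E v) (edge_action (edges_at E v)) \<longleftrightarrow> locally_transitive v" (is "?L \<longleftrightarrow> _")
proof -
  have "simple_graph V E" using tree by (simp add: tree_def)
  then have ga: "group_action ((Aut V E)\<lparr>carrier := {g \<in> G. g v = v}\<rparr>) (edges_at E v) (edge_action (edges_at E v))"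
    by (rule group_action_edges[OF stab_subgroup[OF v]])
      (auto simp: edges_at_def intro: edge_image image_eqI[where x = v])
  have "?L \<longleftrightarrow> (\<forall>e\<in>edges_at E v. \<forall>f\<in>edges_at E v. \<exists>g\<in>{g \<in> G. g v = v}. edge_action (edges_at E v) g e = f)"
    using ga by (auto simp: transitive_action_def transitive_action_axioms_def)
  also have "\<dots> \<longleftrightarrow> (\<forall>a\<in>nbrs v. \<forall>b\<in>nbrs v. \<exists>g\<in>{g \<in> G. g v = v}. edge_action (edges_at E v) g {v, a} = {v, b})"
    unfolding edges_at_eq by blast
  also have "\<dots> \<longleftrightarrow> locally_transitive v"
  proof -
    have *: "edge_action (edges_at E v) g {v, a} = {v, b} \<longleftrightarrow> g a = b"
      if "g v = v" "a \<in> nbrs v" for g a b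
      using edges_action[of g v a] that by (auto simp: doubleton_eq_iff)
    show ?thesis unfolding locally_transitive_def
      by (intro ball_cong refl) (use * in blast)
  qed
  finally show ?thesis .
qed

text \<open>Invariant equivalence relations are carried in both directions along the bijection
  between neighbours of \<open>v\<close> and edges at \<open>v\<close>.\<close>

lemma primitive_action_iff:
  assumes v: "v \<in> V"
  shows "primitive_action ((Aut V E)\<lparr>carrier := {g \<in> G. g v = v}\<rparr>)
    (edges_at E v) (edge_action (edges_at E v)) \<longleftrightarrow> locally_primitive v"
proof -
  let ?f = "\<lambda>a. {v, a}" and ?S = "edges_at E v" and ?N = "nbrs v"
  have inj: "?f a = ?f b \<longleftrightarrow> a = b" for a b using injD[OF inj_edges_at, of v a b] by auto
  have "(\<forall>R. equiv ?S R \<and> (\<forall>g\<in>{g \<in> G. g v = v}. \<forall>x y. (x, y) \<in> R \<longrightarrow>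
            (edge_action ?S g x, edge_action ?S g y) \<in> R) \<longrightarrow> R = Id_on ?S \<or> R = ?S \<times> ?S) \<longleftrightarrow>
        (\<forall>r. equiv ?N r \<and> (\<forall>g\<in>G. g v = v \<longrightarrow> (\<forall>a b. (a, b) \<in> r \<longrightarrow> (g a, g b) \<in> r)) \<longrightarrow>
          r = Id_on ?N \<or> r = ?N \<times> ?N)" (is "(\<forall>R. ?P R) \<longleftrightarrow> (\<forall>r. ?Q r)")
  proof (intro iffI allI impI)
    fix r assume P: "\<forall>R. ?P R"
      and r: "equiv ?N r \<and> (\<forall>g\<in>G. g v = v \<longrightarrow> (\<forall>a b. (a, b) \<in> r \<longrightarrow> (g a, g b) \<in> r))"
    define R where "R = {(?f a, ?f b) | a b. (a, b) \<in> r}"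
    have rN: "a \<in> ?N \<and> b \<in> ?N" if "(a, b) \<in> r" for a b using r that by (auto simp: equiv_def)
    have Rr: "(?f a, ?f b) \<in> R \<longleftrightarrow> (a, b) \<in> r" for a b unfolding R_def using inj by auto
    have "equiv ?S R"
    proof (rule equivI)
      show "R \<subseteq> ?S \<times> ?S" using rN by (auto simp: R_def edges_at_eq)
      show "refl_on ?S R"
        using r Rr by (auto simp: refl_on_def equiv_def edges_at_eq)
      show "sym R" using r unfolding R_def sym_def equiv_def by blast
      show "trans R"
      proof (rule transI)
        fix x y z assume "(x, y) \<in> R" "(y, z) \<in> R"
        then obtain a b c where "x = ?f a" "y = ?f b" "z = ?f c" "(a, b) \<in> r" "(b, c) \<in> r"
          unfolding R_def using inj by auto
        then show "(x, z) \<in> R" using r Rr unfolding equiv_def by (metis transD)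
      qed
    qed
    moreover have "(edge_action ?S g x, edge_action ?S g y) \<in> R"
      if g: "g \<in> G" "g v = v" and xy: "(x, y) \<in> R" for g x y
    proof -
      obtain a b where ab: "x = ?f a" "y = ?f b" "(a, b) \<in> r" using xy by (auto simp: R_def)
      then show ?thesis using rN[OF ab(3)] edges_action[of g v] Rr r g by (simp del: nbrs_iff)
    qed
    ultimately have "R = Id_on ?S \<or> R = ?S \<times> ?S" using P by blast
    then show "r = Id_on ?N \<or> r = ?N \<times> ?N"
    proof
      assume R: "R = Id_on ?S"
      have "(a, b) \<in> r \<longleftrightarrow> a = b \<and> a \<in> ?N" for a b
        using Rr[of a b] rN[of a b] unfolding R Id_on_def by (auto simp: edges_at_eq inj)
      then show ?thesis by (auto simp: Id_on_def)
    next
      assume R: "R = ?S \<times> ?S"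
      have "(a, b) \<in> r \<longleftrightarrow> a \<in> ?N \<and> b \<in> ?N" for a b
        using Rr[of a b] rN[of a b] unfolding R by (auto simp: edges_at_eq)
      then show ?thesis by auto
    qed
  next
    fix R assume Q: "\<forall>r. ?Q r"
      and R: "equiv ?S R \<and> (\<forall>g\<in>{g \<in> G. g v = v}. \<forall>x y. (x, y) \<in> R \<longrightarrow>
            (edge_action ?S g x, edge_action ?S g y) \<in> R)"
    define r where "r = {(a, b). (?f a, ?f b) \<in> R}"
    have RS: "x \<in> ?S \<and> y \<in> ?S" if "(x, y) \<in> R" for x y using R that by (auto simp: equiv_def)
    have fS: "?f a \<in> ?S \<longleftrightarrow> a \<in> ?N" for a by (auto simp: edges_at_def)
    have rN: "a \<in> ?N \<and> b \<in> ?N" if "(a, b) \<in> r" for a b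
      using that RS[of "?f a" "?f b"] fS unfolding r_def by blast
    have "equiv ?N r"
    proof (rule equivI)
      show "r \<subseteq> ?N \<times> ?N" using rN by auto
      show "refl_on ?N r" using R fS unfolding refl_on_def equiv_def r_def by auto
      show "sym r" using R unfolding sym_def equiv_def r_def by blast
      show "trans r" using R unfolding trans_def equiv_def r_def by blast
    qed
    moreover have "(g a, g b) \<in> r" if g: "g \<in> G" "g v = v" and ab: "(a, b) \<in> r" for g a b
    proof -
      have "(edge_action ?S g (?f a), edge_action ?S g (?f b)) \<in> R" using g ab R by (simp add: r_def)
      then show ?thesis using edges_action[of g v] rN[OF ab] g by (simp add: r_def del: nbrs_iff)
    qed
    ultimately have "r = Id_on ?N \<or> r = ?N \<times> ?N" using Q by blast
    then show "R = Id_on ?S \<or> R = ?S \<times> ?S"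
    proof
      assume r: "r = Id_on ?N"
      have "(x, y) \<in> R \<longleftrightarrow> x = y \<and> x \<in> ?S" for x y
      proof
        assume xy: "(x, y) \<in> R"
        then obtain a b where "x = ?f a" "y = ?f b" using RS unfolding edges_at_eq by blast
        moreover then have "(a, b) \<in> r" using xy by (simp add: r_def)
        ultimately show "x = y \<and> x \<in> ?S" using RS[OF xy] r by auto
      next
        assume "x = y \<and> x \<in> ?S"
        then show "(x, y) \<in> R" using R by (auto simp: equiv_def refl_on_def)
      qed
      then show ?thesis by (auto simp: Id_on_def)
    next
      assume r: "r = ?N \<times> ?N"
      have "(x, y) \<in> R" if xy: "x \<in> ?S" "y \<in> ?S" for x y
      proof -
        obtain a b where ab: "x = ?f a" "y = ?f b" "a \<in> ?N" "b \<in> ?N"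
          using xy edges_at_eq by auto
        then have "(a, b) \<in> r" by (simp add: r del: nbrs_iff)
        then show ?thesis using ab by (simp add: r_def)
      qed
      then show ?thesis using RS by auto
    qed
  qed
  then show ?thesis
    using transitive_action_iff[OF v] by (simp add: primitive_action_def locally_primitive_def)
qed

end

context simple_tree_action
begin

text \<open>Colour \<open>x\<close> by the parity of the number of edges of \<open>Q\<close> on the geodesic from a root to \<open>x\<close>.
  An element of \<open>G\<close> either preserves or exchanges the colours; those preserving them form a subgroup
  containing all vertex stabilisers.\<close>

lemma parity_colouring:
  assumes Q: "\<And>g e. g \<in> G \<Longrightarrow> e \<in> Q \<Longrightarrow> g ` e \<in> Q"
  obtains h :: "'a \<Rightarrow> bool" where
    "\<And>x y. {x, y} \<in> E \<Longrightarrow> (h x \<noteq> h y) = ({x, y} \<in> Q)"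
    "\<And>g x. g \<in> G \<Longrightarrow> x \<in> V \<Longrightarrow> h (g x) = h x"
proof -
  obtain r where r: "r \<in> V" using V_nonempty by blast
  obtain h :: "'a \<Rightarrow> bool" where h: "\<And>x y. {x, y} \<in> E \<Longrightarrow> d r y = Suc (d r x) \<Longrightarrow> h y = (h x \<noteq> ({x, y} \<in> Q))"
    using tree_recursion[OF r, of False "\<lambda>x y b. b \<noteq> ({x, y} \<in> Q)"] by metis
  have hQ: "(h x \<noteq> h y) = ({x, y} \<in> Q)" if xy: "{x, y} \<in> E" for x y
  proof -
    have yx: "{y, x} \<in> E" using xy by (simp add: insert_commute)
    have c: "{y, x} = {x, y}" by (simp add: insert_commute)
    from adj_dist[OF xy r] show ?thesis
    proof
      assume "d r y = Suc (d r x)"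
      from h[OF xy this] show ?thesis by blast
    next
      assume "d r x = Suc (d r y)"
      from h[OF yx this] show ?thesis unfolding c by blast
    qed
  qed
  define M where "M = {g \<in> G. \<forall>x\<in>V. h (g x) = h x}"
  have "M = G"
  proof (rule subgroup_containing_stabilisers[OF _ _ r])
    show "M \<subseteq> G" by (auto simp: M_def)
    show "subgroup M (Aut V E)"
    proof (rule G_subgroupI)
      show "inv\<^bsub>Aut V E\<^esub> g \<in> M" if g: "g \<in> M" for g
      proof -
        have "h ((inv\<^bsub>Aut V E\<^esub> g) x) = h x" if x: "x \<in> V" for x
        proof -
          have "(inv\<^bsub>Aut V E\<^esub> g) x \<in> V" using g x G_in G_inv by (simp add: M_def)
          then have "h (g ((inv\<^bsub>Aut V E\<^esub> g) x)) = h ((inv\<^bsub>Aut V E\<^esub> g) x)" using g by (simp add: M_def)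
          then show ?thesis using g x by (simp add: M_def G_inv_apply)
        qed
        then show ?thesis using g by (simp add: M_def G_inv)
      qed
    qed (auto simp: M_def G_one one_apply G_mult G_mult_apply G_in)
    fix k g assume g: "k \<in> G" "g \<in> G" "g (k r) = k r"
    have kr: "k r \<in> V" using g r G_in by blast
    \<comment> \<open>Both \<open>h\<close> and its translate by \<open>g\<close> change exactly
      across the invariant set \<open>Q\<close>, and they agree at the fixed vertex
      \<open>k r\<close>; agreement then propagates along the tree.\<close>
    have "h (g x) = h x" if "x \<in> V" for x
      using kr that
    proof (induction rule: tree_induct)
      case (step x y)
      have "(h (g x) \<noteq> h (g y)) = ({g x, g y} \<in> Q)" using hQ G_adjI g(2) step(1) by blast
      also have "\<dots> = ({x, y} \<in> Q)" using edge_set_invariant[OF Q g(2)] adj_in[OF step(1)] by blast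
      also have "\<dots> = (h x \<noteq> h y)" using hQ[OF step(1)] by blast
      finally show ?case using step by blast
    qed (use g in simp)
    then show "g \<in> M" using g by (simp add: M_def)
  qed
  then show ?thesis using that[of h] hQ by (auto simp: M_def)
qed

end

section \<open>Minimality and cocompactness\<close>

locale tits_tree_action = loc_finite_tree + simple_tree_action +
  assumes valence: "v \<in> V \<Longrightarrow> 3 \<le> valence E v"
    and closed: "closedin (perm_top V E) G"
    and compact_gen: "compactly_generated ((Aut V E)\<lparr>carrier := G\<rparr>) (subtopology (perm_top V E) G)"
    and minimal: "\<nexists>V' E'. subtree V' E' V E \<and> (V', E') \<noteq> (V, E) \<and>
           (\<forall>g\<in>G. g ` V' = V' \<and> (\<lambda>e. g ` e) ` E' = E')"
    and tits: "tits_independence V E G"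
begin

text \<open>The usable form of minimality: the subgraph induced on \<open>X\<close> is an invariant
  subtree.\<close>

lemma invariant_connected_set:
  assumes X: "X \<subseteq> V" "X \<noteq> {}" and inv: "\<And>g x. g \<in> G \<Longrightarrow> x \<in> X \<Longrightarrow> g x \<in> X"
    and conn: "\<And>x y. x \<in> X \<Longrightarrow> y \<in> X \<Longrightarrow> (x, y) \<in> (arcs {e \<in> E. e \<subseteq> X})\<^sup>*"
  shows "X = V"
proof (rule ccontr)
  assume ne: "X \<noteq> V"
  define E' where "E' = {e \<in> E. e \<subseteq> X}"
  have "tree X E'"
    unfolding tree_def
  proof (intro conjI notI)
    show "simple_graph X E'" using tree by (auto simp: tree_def simple_graph_def E'_def)
    show "connected_graph X E'"
      unfolding connected_graph_def
    proof (intro ballI)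
      fix x y assume "x \<in> X" "y \<in> X"
      then show "\<exists>p. walk X E' p \<and> hd p = x \<and> last p = y"
        using rtrancl_imp_distinct_walk[of E' X y x] conn by (fastforce simp: E'_def)
    qed
    assume "\<exists>p. cycle X E' p"
    then obtain p where p: "cycle X E' p" by blast
    then have "successively (\<lambda>x y. {x, y} \<in> E') p" by (auto simp: cycle_def walk_def)
    then have "successively (\<lambda>x y. {x, y} \<in> E) p" by (rule successively_mono) (auto simp: E'_def)
    then have "cycle V E p" using p X(1) by (auto simp: cycle_def walk_def E'_def)
    then show False using tree by (auto simp: tree_def)
  qed (use X in simp)
  then have "subtree X E' V E" using X by (auto simp: subtree_def E'_def)
  moreover have "g ` X = X" if g: "g \<in> G" for g
  proof
    show "X \<subseteq> g ` X"
    proof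
      fix x assume x: "x \<in> X"
      then have "x = g ((inv\<^bsub>Aut V E\<^esub> g) x)" using G_inv_apply[OF g] X by auto
      then show "x \<in> g ` X" using inv[OF G_inv[OF g] x] by blast
    qed
  qed (use inv g in blast)
  moreover have "(\<lambda>e. g ` e) ` E' = E'" if g: "g \<in> G" for g
  proof
    have *: "k ` e \<in> E'" if "k \<in> G" "e \<in> E'" for k e
      using that edge_image inv by (auto simp: E'_def)
    then show "(\<lambda>e. g ` e) ` E' \<subseteq> E'" using g by blast
    show "E' \<subseteq> (\<lambda>e. g ` e) ` E'"
    proof
      fix e assume e: "e \<in> E'"
      have "e = g ` (inv\<^bsub>Aut V E\<^esub> g) ` e"
        using e edge_sub G_inv_apply[OF g] by (force simp: E'_def image_image)
      then show "e \<in> (\<lambda>e. g ` e) ` E'" using *[OF G_inv[OF g] e] by blast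
    qed
  qed
  moreover have "(X, E') \<noteq> (V, E)" using ne by simp
  ultimately show False
    using minimal[unfolded not_ex, rule_format, of X E'] by blast
qed

text \<open>The compact generating set moves \<open>v\<close> by a bounded distance
  \<open>n\<close>. The translates of the ball \<open>F\<close> of radius \<open>n\<close> about
  \<open>v\<close> therefore have a connected union, which is all of \<open>V\<close> by
  minimality.\<close>

lemma cocompact:
  obtains F where "finite F" "F \<subseteq> V" "\<And>x. x \<in> V \<Longrightarrow> \<exists>g\<in>G. \<exists>f\<in>F. x = g f"
proof -
  obtain K where K: "compactin (subtopology (perm_top V E) G) K"
    and gen: "generate ((Aut V E)\<lparr>carrier := G\<rparr>) K = G"
    using compact_gen by (auto simp: compactly_generated_def)
  obtain v where v: "v \<in> V" using V_nonempty by blast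
  have KG: "K \<subseteq> G" and Kc: "compactin (perm_top V E) K" using K by (auto simp: compactin_subtopology)
  have fin: "finite ((\<lambda>k. d v (k v)) ` K)"
    using finite_imageI[OF compact_imp_finite_orbit[OF Kc v], of "d v"] by (simp add: image_image)
  then obtain n where n: "\<And>k. k \<in> K \<Longrightarrow> d v (k v) \<le> n"
    by (meson finite_nat_set_iff_bounded_le image_eqI)
  define F where "F = {x \<in> V. d v x \<le> n}"
  have F: "finite F" "F \<subseteq> V" using finite_ball[OF v] by (auto simp: F_def)
  define X where "X = (\<Union>g\<in>G. g ` F)"
  define EF where "EF = {e \<in> E. e \<subseteq> X}"
  have FX: "F \<subseteq> X"
  proof
    fix x assume "x \<in> F"
    then have "x = \<one>\<^bsub>Aut V E\<^esub> x" "x \<in> F" using F(2) one_apply by auto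
    then show "x \<in> X" unfolding X_def using G_one by blast
  qed
  have XV: "X \<subseteq> V" using G_in F(2) by (auto simp: X_def)
  have inv: "g x \<in> X" if g: "g \<in> G" and x: "x \<in> X" for g x
  proof -
    obtain k f where "k \<in> G" "f \<in> F" "x = k f" using x by (auto simp: X_def)
    moreover then have "g x = (g \<otimes>\<^bsub>Aut V E\<^esub> k) f" using g F(2) by (auto simp: G_mult_apply)
    ultimately show ?thesis using g G_mult unfolding X_def by blast
  qed
  have EF: "g ` e \<in> EF" if "g \<in> G" "e \<in> EF" for g e
    using that edge_image inv by (auto simp: EF_def)
  have ball: "(v, x) \<in> (arcs EF)\<^sup>*" if x: "x \<in> F" for x
  proof (rule arcs_mono[OF _ geodesic[OF v]])
    show "{e \<in> E. \<forall>z\<in>e. z = x \<or> d v z < d v x} \<subseteq> EF"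
    proof
      fix e assume e: "e \<in> {e \<in> E. \<forall>z\<in>e. z = x \<or> d v z < d v x}"
      have "e \<subseteq> F" using e x edge_sub[of e] by (auto simp: F_def)
      then show "e \<in> EF" using e FX by (auto simp: EF_def)
    qed
  qed (use x F in auto)
  \<comment> \<open>For a product of \<open>g\<close> and \<open>k\<close>, the path from
    \<open>v\<close> to \<open>g v\<close> is continued by the \<open>g\<close>-translate of the
    path from \<open>v\<close> to \<open>k v\<close>.\<close>
  have orb: "(v, g v) \<in> (arcs EF)\<^sup>*" if "g \<in> G" for g
  proof -
    have "g \<in> generate ((Aut V E)\<lparr>carrier := G\<rparr>) K" using that gen by simp
    then show ?thesis
    proof (induction rule: generate.induct)
      case one
      then show ?case using v by (simp add: one_apply)
    next
      case (incl k)
      then have "k v \<in> F" using n KG v G_in by (auto simp: F_def)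
      then show ?case by (rule ball)
    next
      case (inv k)
      then have kG: "k \<in> G" using KG by blast
      have "k v \<in> F" using inv n kG v G_in by (auto simp: F_def)
      then have "((inv\<^bsub>Aut V E\<^esub> k) v, (inv\<^bsub>Aut V E\<^esub> k) (k v)) \<in> (arcs EF)\<^sup>*"
        by (rule G_arcs[OF ball]) (rule EF[OF G_inv[OF kG]])
      then show ?case
        using A.m_inv_consistent[OF G kG] kG v by (simp add: G_inv_apply arcs_rtrancl_sym)
    next
      case (eng g k)
      then have gk: "g \<in> G" "k \<in> G" by (simp_all add: gen)
      have "(g v, g (k v)) \<in> (arcs EF)\<^sup>*"
        by (rule G_arcs[OF eng.IH(2)]) (use EF gk in blast)
      then have "(v, g (k v)) \<in> (arcs EF)\<^sup>*" using eng.IH(1) by (meson rtrancl_trans)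
      then show ?case using gk v by (simp add: G_mult_apply)
    qed
  qed
  have vX: "(v, x) \<in> (arcs EF)\<^sup>*" if x: "x \<in> X" for x
  proof -
    obtain g f where gf: "g \<in> G" "f \<in> F" "x = g f" using x by (auto simp: X_def)
    have "(g v, g f) \<in> (arcs EF)\<^sup>*"
      by (rule G_arcs[OF ball[OF gf(2)]]) (use EF gf in blast)
    then show ?thesis using orb[OF gf(1)] gf(3) by (meson rtrancl_trans)
  qed
  have "X = V"
  proof (rule invariant_connected_set[OF XV])
    have "v \<in> F" using v by (simp add: F_def)
    then show "X \<noteq> {}" using FX by blast
    show "(x, y) \<in> (arcs {e \<in> E. e \<subseteq> X})\<^sup>*" if "x \<in> X" "y \<in> X" for x y
      using vX[OF that(1)] vX[OF that(2)] arcs_rtrancl_sym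
      unfolding EF_def by (meson rtrancl_trans)
  qed (use inv in auto)
  then show ?thesis using that[OF F] unfolding X_def by blast
qed

end

section \<open>Infinite blocks\<close>

context tree_action
begin

lemma locally_transitiveD:
  "locally_transitive v \<Longrightarrow> {v, a} \<in> E \<Longrightarrow> {v, b} \<in> E \<Longrightarrow> \<exists>g\<in>G. g v = v \<and> g a = b"
  by (simp add: locally_transitive_def)

text \<open>An element fixing \<open>y\<close> can turn the edge through which \<open>y\<close> is
  reached into any other edge at \<open>y\<close>, so the orbit of one edge spreads over the
  tree.\<close>

lemma edge_transitive:
  assumes LT: "\<And>v. v \<in> V \<Longrightarrow> locally_transitive v" and e: "e \<in> E" and f: "f \<in> E"
  obtains g where "g \<in> G" "g ` e = f"
proof -
  obtain v u where vu: "e = {v, u}" using edge_ends[OF e] .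
  obtain x y where xy: "f = {x, y}" using edge_ends[OF f] .
  have V: "v \<in> V" "x \<in> V" using adj_in e f vu xy by auto
  \<comment> \<open>The claim covers all edges at \<open>x\<close> at once, so that the edge leading
    to the next vertex is already in the orbit.\<close>
  have "\<forall>z. {x, z} \<in> E \<longrightarrow> (\<exists>g\<in>G. g ` {v, u} = {x, z})"
    using V
  proof (induction rule: tree_induct)
    case root
    show ?case
    proof (intro allI impI)
      fix z assume "{v, z} \<in> E"
      then obtain g where "g \<in> G" "g v = v" "g u = z"
        using locally_transitiveD[OF LT[OF V(1)]] e vu by blast
      then show "\<exists>g\<in>G. g ` {v, u} = {v, z}" by auto
    qed
  next
    case (step x y)
    show ?case
    proof (intro allI impI)
      fix z assume z: "{y, z} \<in> E"
      obtain g where g: "g \<in> G" "g ` {v, u} = {x, y}" using step by blast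
      have "locally_transitive y" using LT adj_in[OF z] by blast
      moreover have "{y, x} \<in> E" using step(1) by (simp add: insert_commute)
      ultimately obtain k where k: "k \<in> G" "k y = y" "k x = z"
        using z locally_transitiveD by blast
      have vuV: "v \<in> V" "u \<in> V" using adj_in e vu by auto
      have "(k \<otimes>\<^bsub>Aut V E\<^esub> g) ` {v, u} = k ` g ` {v, u}"
        using G_mult_apply[OF k(1) g(1)] vuV by simp
      also have "\<dots> = {y, z}" using k unfolding g(2) by auto
      finally show "\<exists>g\<in>G. g ` {v, u} = {y, z}" using G_mult[OF k(1) g(1)] by blast
    qed
  qed
  then show ?thesis using that f unfolding vu xy by blast
qed

end

section \<open>Condition (i) implies condition (ii)\<close>

context tits_tree_action
begin

lemma third_nbr:
  assumes "v \<in> V"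
  obtains c where "{v, c} \<in> E" "c \<noteq> a" "c \<noteq> b"
proof -
  have "\<not> nbrs v \<subseteq> {a, b}"
  proof
    assume "nbrs v \<subseteq> {a, b}"
    then have "card (nbrs v) \<le> card {a, b}" by (intro card_mono) auto
    also have "\<dots> \<le> 2" by (simp add: card_insert_if)
    finally show False using valence[OF assms] card_nbrs by simp
  qed
  then obtain c where "c \<in> nbrs v" "c \<notin> {a, b}" by blast
  then show ?thesis using that[of c] by simp
qed

lemma farther_nbr:
  assumes "r \<in> V" "v \<in> V"
  obtains c where "{v, c} \<in> E" "d r v < d r c"
proof -
  obtain a where a: "{v, a} \<in> E" using third_nbr[OF assms(2)] by metis
  obtain b where b: "{v, b} \<in> E" "b \<noteq> a" using third_nbr[OF assms(2)] by metis
  show ?thesis using farther_of_two[OF assms(1) a b(1)] a b that by auto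
qed

lemma infinite_if_no_farthest:
  assumes "Y \<noteq> {}" and "\<And>y. y \<in> Y \<Longrightarrow> \<exists>y'\<in>Y. d r y < d r y'"
  shows "infinite Y"
proof
  assume fin: "finite Y"
  then have "Max (d r ` Y) \<in> d r ` Y" using assms(1) by (intro Max_in) auto
  then obtain y where y: "y \<in> Y" "d r y = Max (d r ` Y)" by auto
  obtain y' where "y' \<in> Y" "d r y < d r y'" using assms(2)[OF y(1)] by blast
  moreover have "d r y' \<le> Max (d r ` Y)" using fin \<open>y' \<in> Y\<close> by simp
  ultimately show False using y(2) by simp
qed

text \<open>An element mapping an edge at \<open>x\<close> to an edge at \<open>y\<close> cannot
  send \<open>x\<close> to the wrong end, because it preserves the proper colouring
  \<open>h\<close>.\<close>

lemma same_type:
  assumes LT: "\<And>v. v \<in> V \<Longrightarrow> locally_transitive v"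
    and h: "\<And>x y. {x, y} \<in> E \<Longrightarrow> h x \<noteq> (h y :: bool)"
    and hG: "\<And>g x. g \<in> G \<Longrightarrow> x \<in> V \<Longrightarrow> h (g x) = h x"
    and x: "x \<in> V" and y: "y \<in> V" and eq: "h y = h x"
  shows "\<exists>g\<in>G. g x = y"
proof -
  obtain x' where x': "{x, x'} \<in> E" using third_nbr[OF x] by metis
  obtain y' where y': "{y, y'} \<in> E" using third_nbr[OF y] by metis
  obtain g where g: "g \<in> G" "g ` {x, x'} = {y, y'}" using edge_transitive[OF LT x' y'] .
  have "g x \<noteq> y'" using hG[OF g(1) x] h[OF y'] eq by auto
  then have "g x = y" using g(2) by (auto simp: doubleton_eq_iff)
  then show ?thesis using g(1) by blast
qed

text \<open>This is condition (i).\<close>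

definition proper_open_compact :: bool where
  "proper_open_compact \<longleftrightarrow> (\<forall>H. subgroup H ((Aut V E)\<lparr>carrier := G\<rparr>) \<and>
      openin (subtopology (perm_top V E) G) H \<and> H \<noteq> G \<longrightarrow>
      compactin (subtopology (perm_top V E) G) H)"

text \<open>The stabiliser of a block \<open>Y\<close> acts on \<open>Y\<close> with finitely many orbits by cocompactness, and
  if it is proper, its orbits are finite by compactness.\<close>

lemma infinite_block_invariant:
  assumes poc: proper_open_compact and Y: "Y \<subseteq> V" "infinite Y"
    and block: "\<And>g y z. g \<in> G \<Longrightarrow> y \<in> Y \<Longrightarrow> g y \<in> Y \<Longrightarrow> z \<in> Y \<Longrightarrow> g z \<in> Y"
    and g: "g \<in> G" and y: "y \<in> Y"
  shows "g y \<in> Y"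
proof -
  define H where "H = {g \<in> G. \<forall>z\<in>Y. g z \<in> Y}"
  have HG: "H \<subseteq> G" by (auto simp: H_def)
  have HI: "k \<in> H" if "k \<in> G" "z \<in> Y" "k z \<in> Y" for k z
    using block[OF that] that(1) by (auto simp: H_def)
  have YV: "z \<in> V" if "z \<in> Y" for z using Y that by blast
  have sub: "subgroup H (Aut V E)"
  proof (rule G_subgroupI[OF HG])
    show "\<one>\<^bsub>Aut V E\<^esub> \<in> H" using G_one one_apply YV by (auto simp: H_def)
    fix g assume g: "g \<in> H"
    then have gG: "g \<in> G" by (simp add: H_def)
    show "inv\<^bsub>Aut V E\<^esub> g \<in> H"
    proof (rule HI[OF G_inv[OF gG]])
      show "g y \<in> Y" using g y by (simp add: H_def)
      show "(inv\<^bsub>Aut V E\<^esub> g) (g y) \<in> Y" using gG y YV by (simp add: G_inv_apply)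
    qed
    fix k assume "k \<in> H"
    then show "g \<otimes>\<^bsub>Aut V E\<^esub> k \<in> H" using g YV by (auto simp: H_def G_mult G_mult_apply)
  qed
  have opn: "openin (subtopology (perm_top V E) G) H"
    by (rule openin_subgroupI[OF sub HG, of "{y}"]) (use y YV HI in auto)
  have "H = G"
  proof (rule ccontr)
    assume "H \<noteq> G"
    then have "compactin (subtopology (perm_top V E) G) H"
      using poc opn A.subgroup_incl[OF sub G HG] by (auto simp: proper_open_compact_def)
    then have orb: "finite ((\<lambda>k. k x) ` H)" if "x \<in> V" for x
      using compact_imp_finite_orbit that by (auto simp: compactin_subtopology)
    obtain F where F: "finite F" "F \<subseteq> V" "\<And>x. x \<in> V \<Longrightarrow> \<exists>g\<in>G. \<exists>f\<in>F. x = g f"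
      using cocompact by blast
    \<comment> \<open>\<open>p f\<close> moves the representative \<open>f\<close> into
      \<open>Y\<close> when this is possible. If \<open>k f\<close> also lies in \<open>Y\<close>,
      then \<open>k\<close> times the inverse of \<open>p f\<close> maps a point of \<open>Y\<close>
      into \<open>Y\<close> and so belongs to \<open>H\<close>.\<close>
    define p where "p f = (SOME k. k \<in> G \<and> k f \<in> Y)" for f
    \<comment> \<open>The index set is restricted to \<open>p f f\<close> in \<open>V\<close>
      because the choice of \<open>p f\<close> is arbitrary when no translate of \<open>f\<close>
      meets \<open>Y\<close>.\<close>
    have "Y \<subseteq> (\<Union>f\<in>{f \<in> F. p f f \<in> V}. (\<lambda>k. k (p f f)) ` H)"
    proof
      fix z assume z: "z \<in> Y"
      then obtain k f where k: "k \<in> G" "f \<in> F" "z = k f" using F(3) YV by blast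
      have p: "p f \<in> G \<and> p f f \<in> Y" unfolding p_def by (rule someI[of _ k]) (use k z in simp)
      let ?q = "k \<otimes>\<^bsub>Aut V E\<^esub> inv\<^bsub>Aut V E\<^esub> (p f)"
      have fV: "f \<in> V" using k F by blast
      have q: "?q (p f f) = z" "?q \<in> G"
        using p k fV by (simp_all add: G_mult_apply G_inv G_inv_apply G_in G_mult)
      have "?q \<in> H" using HI[OF q(2), of "p f f"] p q(1) z by simp
      then show "z \<in> (\<Union>f\<in>{f \<in> F. p f f \<in> V}. (\<lambda>k. k (p f f)) ` H)" using q(1) k(2) p YV by blast
    qed
    moreover have "finite (\<Union>f\<in>{f \<in> F. p f f \<in> V}. (\<lambda>k. k (p f f)) ` H)"
      using F(1) orb by auto
    ultimately have "finite Y" using finite_subset by blast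
    then show False using Y(2) by blast
  qed
  then show ?thesis using g y by (auto simp: H_def)
qed

text \<open>\<open>Q\<close> is the deleted edge orbit and \<open>Y\<close> the component of
  \<open>v\<close> in what remains. The colouring is constant on \<open>Y\<close> but differs at
  \<open>u\<close>, so \<open>Y\<close> cannot be all of \<open>V\<close>.\<close>

lemma compact_imp_locally_transitive:
  assumes poc: proper_open_compact and v: "v \<in> V"
  shows "locally_transitive v"
proof (rule ccontr)
  assume "\<not> locally_transitive v"
  then obtain a b where ab: "a \<in> nbrs v" "b \<in> nbrs v" "\<not> (\<exists>g\<in>G. g v = v \<and> g a = b)"
    by (auto simp: locally_transitive_def simp del: nbrs_iff)
  have ne: "a \<noteq> b" using ab G_one one_apply v adj_in[of v a] by auto
  obtain c where c: "{v, c} \<in> E" "c \<noteq> a" "c \<noteq> b" using third_nbr[OF v] by metis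
  have nV: "a \<in> V" "b \<in> V" "c \<in> V" using ab c adj_in[of v] by auto
  \<comment> \<open>An orbit of the stabiliser of \<open>v\<close> is needed that misses two
    neighbours. The orbit of \<open>a\<close> misses \<open>b\<close>; if it also misses
    \<open>c\<close>, take \<open>u = a\<close>. Otherwise \<open>a\<close> and \<open>c\<close>
    share an orbit without \<open>b\<close>, and \<open>u = b\<close> works.\<close>
  obtain u w w' where u: "{v, u} \<in> E" "{v, w} \<in> E" "{v, w'} \<in> E" "w \<noteq> w'"
    "\<not> (\<exists>g\<in>G. g v = v \<and> g u = w)" "\<not> (\<exists>g\<in>G. g v = v \<and> g u = w')"
  proof (cases "\<exists>g\<in>G. g v = v \<and> g a = c")
    case False
    then show ?thesis using that[of a b c] ab c by auto
  next
    case True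
    then obtain g where g: "g \<in> G" "g v = v" "g a = c" by blast
    have "k b \<noteq> a" if k: "k \<in> G" "k v = v" for k
    proof
      assume "k b = a"
      then have "(inv\<^bsub>Aut V E\<^esub> k) a = b" "(inv\<^bsub>Aut V E\<^esub> k) v = v"
        using inv_image_eq[OF k(1)] k(2) nV v by simp_all
      then show False using ab(3) G_inv[OF k(1)] by blast
    qed
    moreover have "k b \<noteq> c" if k: "k \<in> G" "k v = v" for k
    proof
      assume "k b = c"
      then have i: "(inv\<^bsub>Aut V E\<^esub> k) c = b" "(inv\<^bsub>Aut V E\<^esub> k) v = v"
        using inv_image_eq[OF k(1)] k(2) nV v by simp_all
      have "(inv\<^bsub>Aut V E\<^esub> k \<otimes>\<^bsub>Aut V E\<^esub> g) a = b" "(inv\<^bsub>Aut V E\<^esub> k \<otimes>\<^bsub>Aut V E\<^esub> g) v = v"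
        using i g nV v G_inv[OF k(1)] by (simp_all add: G_mult_apply)
      then show False using ab(3) G_mult[OF G_inv[OF k(1)] g(1)] by blast
    qed
    ultimately show ?thesis using that[of b a c] ab c by auto
  qed
  have uV: "u \<in> V" "w \<in> V" "w' \<in> V" using u adj_in by blast+
  define Q where "Q = (\<lambda>g. g ` {v, u}) ` G"
  have Qinv: "g ` e \<in> Q" if g: "g \<in> G" and e: "e \<in> Q" for g e
  proof -
    obtain k where k: "k \<in> G" "e = k ` {v, u}" using e by (auto simp: Q_def)
    then have "g ` e = (g \<otimes>\<^bsub>Aut V E\<^esub> k) ` {v, u}" using g v uV by (simp add: G_mult_apply)
    then show ?thesis using G_mult[OF g k(1)] unfolding Q_def by blast
  qed
  obtain h :: "'a \<Rightarrow> bool" where h: "\<And>x y. {x, y} \<in> E \<Longrightarrow> (h x \<noteq> h y) = ({x, y} \<in> Q)"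
    and hG: "\<And>g x. g \<in> G \<Longrightarrow> x \<in> V \<Longrightarrow> h (g x) = h x"
    using parity_colouring[of Q] Qinv by blast
  have vuQ: "{v, u} \<in> Q"
  proof -
    have "{v, u} = \<one>\<^bsub>Aut V E\<^esub> ` {v, u}" using v uV by (simp add: one_apply)
    then show ?thesis using G_one unfolding Q_def by blast
  qed
  then have hvu: "h u \<noteq> h v" using h[OF u(1)] by blast
  \<comment> \<open>The colours decide which end of an edge of \<open>Q\<close> is the image of
    \<open>v\<close>, so no flip has to be considered.\<close>
  have key: "\<exists>g\<in>G. g v = y \<and> g u = z" if yz: "{y, z} \<in> Q" "h y = h v" for y z
  proof -
    obtain g where g: "g \<in> G" "{y, z} = {g v, g u}" using yz(1) by (auto simp: Q_def)
    have "g u \<noteq> y" using hG[OF g(1) uV(1)] yz(2) hvu by auto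
    then show ?thesis using g by (auto simp: doubleton_eq_iff)
  qed
  have wQ: "{v, w} \<notin> Q" "{v, w'} \<notin> Q" using key[of v] u(5,6) by blast+
  define Y where "Y = {y. (v, y) \<in> (arcs (E - Q))\<^sup>*}"
  have vY: "v \<in> Y" by (simp add: Y_def)
  have Yadj: "z \<in> Y" if "y \<in> Y" "{y, z} \<in> E" "{y, z} \<notin> Q" for y z
    using that unfolding Y_def by (auto intro: rtrancl_into_rtrancl)
  have Yh: "y \<in> V \<and> h y = h v" if "y \<in> Y" for y
  proof -
    have "(v, y) \<in> (arcs (E - Q))\<^sup>*" using that by (simp add: Y_def)
    then show ?thesis
    proof (induction rule: rtrancl_induct)
      case (step y z)
      then show ?case using h[of y z] adj_in[of y z] by auto
    qed (use v in simp)
  qed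
  have EQ: "g ` e \<in> E - Q" if g: "g \<in> G" and e: "e \<in> E - Q" for g e
  proof -
    obtain x y where xy: "e = {x, y}" using edge_ends e by blast
    have "{g x, g y} \<notin> Q"
      using edge_set_invariant[OF Qinv g, of x y] adj_in[of x y] e xy by auto
    then show ?thesis using edge_image[OF g, of e] e xy by auto
  qed
  have block: "g z \<in> Y" if g: "g \<in> G" and y: "y \<in> Y" "g y \<in> Y" "z \<in> Y" for g y z
  proof -
    have "(y, z) \<in> (arcs (E - Q))\<^sup>*"
      using y(1,3) arcs_rtrancl_sym unfolding Y_def by (metis mem_Collect_eq rtrancl_trans)
    then have "(g y, g z) \<in> (arcs (E - Q))\<^sup>*" by (rule G_arcs) (rule EQ[OF g])
    then show ?thesis using y(2) unfolding Y_def by (metis mem_Collect_eq rtrancl_trans)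
  qed
  have far: "\<exists>y'\<in>Y. d v y < d v y'" if y: "y \<in> Y" for y
  proof -
    \<comment> \<open>If an edge of \<open>Q\<close> meets \<open>y\<close>, then \<open>y\<close>
      is a translate of \<open>v\<close> and the images of \<open>w\<close> and \<open>w'\<close>
      serve; otherwise any two neighbours do. One of the two is farther from
      \<open>v\<close>.\<close>
    obtain z z' where z: "{y, z} \<in> E" "{y, z'} \<in> E" "z \<noteq> z'" "{y, z} \<notin> Q" "{y, z'} \<notin> Q"
    proof (cases "\<exists>x. {y, x} \<in> Q")
      case True
      then obtain g where g: "g \<in> G" "g v = y" using key Yh[OF y] by blast
      show ?thesis
      proof (rule that[of "g w" "g w'"])
        show "{y, g w} \<in> E" "{y, g w'} \<in> E" using G_adjI[OF g(1)] u(2,3) g(2) by auto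
        show "g w \<noteq> g w'" using G_inj[OF g(1)] uV u(4) by blast
        show "{y, g w} \<notin> Q" "{y, g w'} \<notin> Q"
          using edge_set_invariant[OF Qinv g(1) v] uV wQ g(2) by auto
      qed
    next
      case False
      obtain z where z: "{y, z} \<in> E" using third_nbr Yh[OF y] by metis
      obtain z' where "{y, z'} \<in> E" "z' \<noteq> z" using third_nbr Yh[OF y] by metis
      then show ?thesis using that[of z z'] z False by auto
    qed
    then show ?thesis using farther_of_two[OF v z(1,2,3)] Yadj[OF y] by blast
  qed
  have "infinite Y" using infinite_if_no_farthest[of Y v] vY far by blast
  moreover have "Y \<subseteq> V" using Yh by blast
  ultimately have inv: "g y \<in> Y" if "g \<in> G" "y \<in> Y" for g y
    using infinite_block_invariant[OF poc, of Y g y] block that by blast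
  have "Y = V"
  proof (rule invariant_connected_set[OF \<open>Y \<subseteq> V\<close>])
    have conn: "(v, y) \<in> (arcs {e \<in> E. e \<subseteq> Y})\<^sup>*" if "y \<in> Y" for y
    proof -
      have "(v, y) \<in> (arcs (E - Q))\<^sup>*" using that by (simp add: Y_def)
      then show ?thesis
      proof (induction rule: rtrancl_induct)
        case (step y z)
        have "y \<in> Y" using step(1) by (simp add: Y_def)
        then have "(y, z) \<in> arcs {e \<in> E. e \<subseteq> Y}" using step(2) Yadj by auto
        then show ?case using step.IH by (rule rtrancl_into_rtrancl[rotated])
      qed simp
    qed
    show "(x, y) \<in> (arcs {e \<in> E. e \<subseteq> Y})\<^sup>*" if "x \<in> Y" "y \<in> Y" for x y
      using arcs_rtrancl_sym[OF conn[OF that(1)]] conn[OF that(2)] by (rule rtrancl_trans)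
  qed (use vY inv in auto)
  then show False using Yh uV hvu by blast
qed

text \<open>An invariant equivalence relation \<open>r\<close> at \<open>v\<close> is spread over the \<open>G\<close>-orbit of \<open>v\<close>; a class of
  the relation it generates meets the neighbours of \<open>v\<close> in a single class of \<open>r\<close>, because along the
  relation the branch at \<open>v\<close> changes only within its class.\<close>

lemma compact_imp_locally_primitive:
  assumes poc: proper_open_compact and v: "v \<in> V"
  shows "locally_primitive v"
proof (rule ccontr)
  have LT: "locally_transitive x" if "x \<in> V" for x
    using compact_imp_locally_transitive[OF poc that] .
  assume "\<not> locally_primitive v"
  then obtain r where r: "equiv (nbrs v) r" "r \<noteq> Id_on (nbrs v)" "r \<noteq> nbrs v \<times> nbrs v"
    and "\<forall>g\<in>G. g v = v \<longrightarrow> (\<forall>a b. (a, b) \<in> r \<longrightarrow> (g a, g b) \<in> r)"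
    using LT[OF v] unfolding locally_primitive_def by metis
  then have rG: "(g a, g b) \<in> r" if "g \<in> G" "g v = v" "(a, b) \<in> r" for g a b
    using that by blast
  have rN: "{v, a} \<in> E \<and> {v, b} \<in> E \<and> a \<in> V \<and> b \<in> V" if "(a, b) \<in> r" for a b
  proof -
    have "a \<in> nbrs v \<and> b \<in> nbrs v" using r(1) that unfolding equiv_def by blast
    then show ?thesis using adj_in[of v a] adj_in[of v b] by auto
  qed
  have rrefl: "(a, a) \<in> r" if "{v, a} \<in> E" for a
    using r(1) that by (auto simp: equiv_def refl_on_def)
  have rtrans: "(a, c) \<in> r" if "(a, b) \<in> r" "(b, c) \<in> r" for a b c
    using r(1) that unfolding equiv_def by (meson transD)
  have rsym: "(b, a) \<in> r" if "(a, b) \<in> r" for a b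
    using r(1) that unfolding equiv_def by (meson symD)
  obtain a b where ab: "(a, b) \<in> r" "a \<noteq> b"
  proof -
    have "\<not> r \<subseteq> Id_on (nbrs v)" using r(2) rrefl by (auto simp: Id_on_def)
    then obtain a b where ab: "(a, b) \<in> r" "(a, b) \<notin> Id_on (nbrs v)" by auto
    then have "a \<noteq> b" using rN[OF ab(1)] by (auto simp: Id_on_def)
    then show ?thesis using that ab by blast
  qed
  obtain c c' where c: "{v, c} \<in> E" "{v, c'} \<in> E" "(c, c') \<notin> r"
  proof -
    have "r \<subseteq> nbrs v \<times> nbrs v" using r(1) by (simp add: equiv_def)
    then have "\<not> nbrs v \<times> nbrs v \<subseteq> r" using r(3) by blast
    then obtain c c' where "c \<in> nbrs v" "c' \<in> nbrs v" "(c, c') \<notin> r" by blast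
    then show ?thesis using that by simp
  qed
  obtain h :: "'a \<Rightarrow> bool" where "\<And>x y. {x, y} \<in> E \<Longrightarrow> (h x \<noteq> h y) = ({x, y} \<in> E)"
    and hG: "\<And>g x. g \<in> G \<Longrightarrow> x \<in> V \<Longrightarrow> h (g x) = h x"
    using parity_colouring[of E] edge_image by blast
  then have h: "h x \<noteq> h y" if "{x, y} \<in> E" for x y using that by blast
  \<comment> \<open>\<open>S\<close> relates neighbours of a translate \<open>g v\<close> that
    correspond under \<open>g\<close> to \<open>r\<close>-related neighbours of \<open>v\<close>;
    \<open>Y\<close> is the class of \<open>c\<close> in the generated equivalence relation.\<close>
  define S where "S = {(x, y). \<exists>g\<in>G. \<exists>p q. (p, q) \<in> r \<and> x = g p \<and> y = g q}"
  define Y where "Y = {y. (c, y) \<in> S\<^sup>*}"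
  have SG: "(g x, g y) \<in> S" if g: "g \<in> G" and S: "(x, y) \<in> S" for g x y
  proof -
    obtain k p q where k: "k \<in> G" "(p, q) \<in> r" "x = k p" "y = k q" using S by (auto simp: S_def)
    then have "g x = (g \<otimes>\<^bsub>Aut V E\<^esub> k) p" "g y = (g \<otimes>\<^bsub>Aut V E\<^esub> k) q"
      using g rN[OF k(2)] by (simp_all add: G_mult_apply)
    then show ?thesis using G_mult[OF g k(1)] k(2) unfolding S_def by blast
  qed
  have SGs: "(g x, g y) \<in> S\<^sup>*" if g: "g \<in> G" and S: "(x, y) \<in> S\<^sup>*" for g x y
    using S
  proof (induction rule: rtrancl_induct)
    case (step y z)
    then show ?case using SG[OF g step(2)] by (meson rtrancl_into_rtrancl)
  qed simp
  have "sym S" using rsym unfolding sym_def S_def by blast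
  then have Ssym: "(y, x) \<in> S\<^sup>*" if "(x, y) \<in> S\<^sup>*" for x y
    using that sym_rtrancl symD by metis
  have Sh: "x \<in> V \<and> y \<in> V \<and> h x \<noteq> h v \<and> h y \<noteq> h v" if xy: "(x, y) \<in> S" for x y
  proof -
    obtain g p q where g: "g \<in> G" "(p, q) \<in> r" "x = g p" "y = g q" using xy by (auto simp: S_def)
    then show ?thesis using rN[OF g(2)] h[of v p] h[of v q] hG[OF g(1)] G_in[OF g(1)] by auto
  qed
  have Yh: "y \<in> V \<and> h y \<noteq> h v" if "y \<in> Y" for y
  proof -
    have "(c, y) \<in> S\<^sup>*" using that by (simp add: Y_def)
    then show ?thesis
    proof (induction rule: rtrancl_induct)
      case base
      then show ?case using c(1) h[of v c] adj_in[of v c] by auto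
    qed (use Sh in blast)
  qed
  have cY: "c \<in> Y" by (simp add: Y_def)
  have block: "g z \<in> Y" if g: "g \<in> G" and y: "y \<in> Y" "g y \<in> Y" "z \<in> Y" for g y z
  proof -
    have "(y, z) \<in> S\<^sup>*" using y(1,3) Ssym unfolding Y_def by (metis mem_Collect_eq rtrancl_trans)
    then have "(g y, g z) \<in> S\<^sup>*" by (rule SGs[OF g])
    then show ?thesis using y(2) unfolding Y_def by (metis mem_Collect_eq rtrancl_trans)
  qed
  have far: "\<exists>y'\<in>Y. d v y < d v y'" if y: "y \<in> Y" for y
  proof -
    have yV: "y \<in> V" using Yh[OF y] by simp
    \<comment> \<open>A neighbour \<open>m\<close> of \<open>y\<close> farther from \<open>v\<close>
      has the colour of \<open>v\<close>, so it is a translate of \<open>v\<close>. The class of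
      \<open>y\<close> at \<open>m\<close> contains another neighbour of \<open>m\<close>, which is
      farther still because only \<open>y\<close> is closer to \<open>v\<close> than
      \<open>m\<close>.\<close>
    obtain m where m: "{y, m} \<in> E" "d v y < d v m" using farther_nbr[OF v yV] .
    have mV: "m \<in> V" using adj_in[OF m(1)] by simp
    have "h m = h v" using h[OF m(1)] Yh[OF y] by auto
    then have "\<exists>k\<in>G. k v = m"
      by (intro same_type[of h]) (simp_all add: LT h hG v mV)
    then obtain k where k: "k \<in> G" "k v = m" by blast
    define p where "p = (inv\<^bsub>Aut V E\<^esub> k) y"
    have kp: "k p = y" "p \<in> V" using G_inv_apply[OF k(1) yV] G_in[OF G_inv[OF k(1)] yV] by (simp_all add: p_def)
    have "{k v, k p} \<in> E" using m(1) k(2) kp(1) by (simp add: insert_commute)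
    then have vp: "{v, p} \<in> E" using G_adj[OF k(1) v kp(2)] by blast
    \<comment> \<open>The non-trivial pair \<open>(a, b)\<close> is moved so that it starts at
      \<open>p\<close>; hence every neighbour of \<open>v\<close> has a partner in its
      class.\<close>
    obtain g where g: "g \<in> G" "g v = v" "g a = p"
      using locally_transitiveD[OF LT[OF v], of a p] rN[OF ab(1)] vp by blast
    define q where "q = g b"
    have pq: "(p, q) \<in> r" using rG[OF g(1,2) ab(1)] g(3) by (simp add: q_def)
    have "p \<noteq> q" using G_inj[OF g(1)] rN[OF ab(1)] ab(2) g(3) by (auto simp: q_def)
    then have ne: "k q \<noteq> y" using G_inj[OF k(1)] rN[OF pq] kp(1) by metis
    have "(y, k q) \<in> S" using k(1) pq kp(1) unfolding S_def by blast
    then have kqY: "k q \<in> Y" using y unfolding Y_def by (auto intro: rtrancl_into_rtrancl)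
    have mq: "{m, k q} \<in> E" using G_adjI[OF k(1)] rN[OF pq] k(2) by blast
    have my: "{m, y} \<in> E" using m(1) by (simp add: insert_commute)
    have "\<not> d v (k q) < d v m" using closer_unique[OF v my mq m(2)] ne by blast
    then have "d v y < d v (k q)" using m(2) by linarith
    then show ?thesis using kqY by blast
  qed
  have "infinite Y" using infinite_if_no_farthest[of Y v] cY far by blast
  moreover have "Y \<subseteq> V" using Yh by blast
  ultimately have inv: "g y \<in> Y" if "g \<in> G" "y \<in> Y" for g y
    using infinite_block_invariant[OF poc, of Y g y] block that by blast
  obtain g where "g \<in> G" "g v = v" "g c = c'"
    using locally_transitiveD[OF LT[OF v] c(1,2)] by blast
  then have "c' \<in> Y" using inv cY by blast
  \<comment> \<open>\<open>d y e < d y v\<close> says that \<open>y\<close> lies in the branch at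
    \<open>v\<close> through \<open>e\<close>. A step of \<open>S\<close> around \<open>v\<close>
    changes \<open>e\<close> within its class; a step around another vertex stays in the branch by
    \<open>crossing\<close>.\<close>
  have "\<exists>e. (c, e) \<in> r \<and> d y e < d y v" if "y \<in> Y" for y
  proof -
    have "(c, y) \<in> S\<^sup>*" using that by (simp add: Y_def)
    then show ?thesis
    proof (induction rule: rtrancl_induct)
      case base
      have "{c, v} \<in> E" using c(1) by (simp add: insert_commute)
      then show ?case using rrefl[OF c(1)] adj_in[of c v] by (intro exI[of _ c]) simp
    next
      case (step y y')
      obtain g p q where g: "g \<in> G" "(p, q) \<in> r" "y = g p" "y' = g q"
        using step(2) by (auto simp: S_def)
      obtain e where e: "(c, e) \<in> r" "d y e < d y v" using step.IH by blast
      have m: "{g v, y} \<in> E" "{g v, y'} \<in> E" using G_adjI[OF g(1)] rN[OF g(2)] g(3,4) by auto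
      have ev: "{e, v} \<in> E" using rN[OF e(1)] by (simp add: insert_commute)
      have ym: "{y, g v} \<in> E" "{y', g v} \<in> E" using m by (simp_all add: insert_commute)
      show ?case
      proof (cases "g v = v")
        case True
        have "d y e = 0" using e(2) ym(1) True by simp
        then have "y = e" using d_eq_0[of y e] rN[OF e(1)] adj_in[OF ym(1)] by simp
        then have "(c, y') \<in> r" using rtrans[OF e(1)] rG[OF g(1) True g(2)] g(3,4) by simp
        moreover have "d y' y' < d y' v" using ym(2) True adj_in[OF ym(2)] by simp
        ultimately show ?thesis by blast
      next
        case False
        have "d (g v) e < d (g v) v" using crossing[OF ev ym(1) e(2)] False by blast
        moreover have "y' \<noteq> v" using Sh[OF step(2)] by blast
        ultimately have "d y' e < d y' v" using crossing[OF ev m(2)] by blast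
        then show ?thesis using e(1) by blast
      qed
    qed
  qed
  then obtain e where e: "(c, e) \<in> r" "d c' e < d c' v" using \<open>c' \<in> Y\<close> by blast
  have "{c', v} \<in> E" using c(2) by (simp add: insert_commute)
  \<comment> \<open>A neighbour of \<open>v\<close> lying in the branch through \<open>e\<close> can
    only be \<open>e\<close>.\<close>
  then have "c' = e" using e(2) d_eq_0[of c' e] rN[OF e(1)] adj_in[of c' v] by simp
  then show False using e(1) c(3) by simp
qed

end

section \<open>Open subgroups with unbounded orbits\<close>

context tree_graph
begin

text \<open>That \<open>z\<close> lies on the geodesic from \<open>v\<close> to \<open>w\<close> is
  expressed by additivity of distances; a step towards \<open>w\<close> must then lead away from
  \<open>v\<close>.\<close>

lemma geodesic_succ:
  assumes V: "v \<in> V" "w \<in> V" "z \<in> V" and z: "d v z + d w z = d v w" and ne: "z \<noteq> w"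
  obtains z' where "{z, z'} \<in> E" "d v z' = Suc (d v z)" "d w z = Suc (d w z')" "d v z' + d w z' = d v w"
proof -
  obtain z' where z': "{z, z'} \<in> E" "d w z = Suc (d w z')" using closer_exists[OF V(2,3) ne] .
  have z'V: "z' \<in> V" using adj_in[OF z'(1)] by simp
  have "d v w \<le> d v z' + d w z'" using d_triangle[OF V(1) z'V V(2)] d_sym[OF V(2) z'V] by simp
  moreover have "d v z' \<le> Suc (d v z)" using d_step[OF z'(1) V(1)] .
  ultimately show ?thesis using that[OF z'(1)] z'(2) z by linarith
qed

lemma geodesic_point:
  assumes "v \<in> V" "w \<in> V" "k \<le> d v w"
  shows "\<exists>z\<in>V. d v z = k \<and> d v z + d w z = d v w"
  using assms(3)
proof (induction k)
  case 0
  then show ?case using assms d_sym by (intro bexI[of _ v]) auto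
next
  case (Suc k)
  then obtain z where z: "z \<in> V" "d v z = k" "d v z + d w z = d v w" by auto
  have "z \<noteq> w" using z Suc.prems by auto
  from geodesic_succ[OF assms(1,2) z(1,3) this] obtain z' where
    z': "{z, z'} \<in> E" "d v z' = Suc (d v z)" "d v z' + d w z' = d v w" by blast
  show ?case using z' z(2) adj_in[OF z'(1)] by (intro bexI[of _ z']) auto
qed

lemma chain_edge:
  assumes "{x, y} \<in> E"
  shows "chain V E {x, y}"
  unfolding chain_def
proof (intro exI conjI)
  let ?c = "\<lambda>i::int. if i = 0 then x else y"
  show "({0, 1} :: int set) \<noteq> {}" by simp
  show "\<forall>i\<in>{0, 1::int}. \<forall>k\<in>{0, 1}. {i..k} \<subseteq> {0, 1}" by auto
  show "inj_on ?c {0, 1}" using adj_neq[OF assms] by (auto simp: inj_on_def)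
  show "{x, y} = ?c ` {0, 1}" by auto
  show "{x, y} \<subseteq> V" using adj_in[OF assms] by simp
  show "\<forall>i. i \<in> {0, 1} \<and> i + 1 \<in> {0, 1} \<longrightarrow> {?c i, ?c (i + 1)} \<in> E"
    using assms by auto
qed

text \<open>By \<open>adj_dist\<close> there are no ties between adjacent vertices, so the choice in
  \<open>closest\<close> is determined and its fibres are the two half-trees.\<close>

lemma closest_edge:
  assumes e: "{x, y} \<in> E" and z: "z \<in> V"
  shows "closest V E {x, y} z = (if d z x < d z y then x else y)"
proof -
  have ne: "d z x \<noteq> d z y" using adj_dist[OF e z] by auto
  have "is_arg_min (d z) (\<lambda>c. c \<in> {x, y}) c \<longleftrightarrow> c = (if d z x < d z y then x else y)" for c
    using ne by (auto simp: is_arg_min_def)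
  then show ?thesis by (simp add: closest_def arg_min_on_def arg_min_def)
qed

end

section \<open>Condition (ii) implies condition (i)\<close>

context tits_tree_action
begin

text \<open>Surjectivity in the independence property for the chain \<open>{x, y}\<close> realises
  the pair consisting of \<open>g\<close> on one half-tree and the identity on the other.\<close>

lemma tits_edge:
  assumes e: "{x, y} \<in> E" and g: "g \<in> G" "g x = x" "g y = y"
  obtains p where "p \<in> G" "\<And>z. z \<in> V \<Longrightarrow> d z x < d z y \<Longrightarrow> p z = g z"
    "\<And>z. z \<in> V \<Longrightarrow> \<not> d z x < d z y \<Longrightarrow> p z = z"
proof -
  define F where "F = pointwise_stabiliser G {x, y}"
  define P where "P = closest_fibre V E {x, y}"
  define f where "f = (\<lambda>g :: 'a \<Rightarrow> 'a. \<lambda>c\<in>{x, y}. restrict g (P c))"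
  have ne: "x \<noteq> y" by (rule adj_neq[OF e])
  have V: "x \<in> V" "y \<in> V" using adj_in[OF e] by auto
  have "f \<in> iso ((Aut V E)\<lparr>carrier := F\<rparr>)
         (product_group {x, y} (\<lambda>c. (BijGroup (P c))\<lparr>carrier := (\<lambda>g. restrict g (P c)) ` F\<rparr>))"
    using tits chain_edge[OF e] unfolding tits_independence_def Let_def f_def F_def P_def by blast
  then have "bij_betw f F (PiE {x, y} (\<lambda>c. (\<lambda>g. restrict g (P c)) ` F))"
    by (simp add: iso_def carrier_product_group)
  then have surj: "f ` F = PiE {x, y} (\<lambda>c. (\<lambda>g. restrict g (P c)) ` F)"
    by (rule bij_betw_imp_surj_on)
  have F: "g \<in> F" "\<one>\<^bsub>Aut V E\<^esub> \<in> F"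
    using g G_one one_apply V by (auto simp: F_def pointwise_stabiliser_def)
  define t where "t = (\<lambda>c\<in>{x, y}. restrict (if c = x then g else \<one>\<^bsub>Aut V E\<^esub>) (P c))"
  have "t \<in> PiE {x, y} (\<lambda>c. (\<lambda>g. restrict g (P c)) ` F)"
    unfolding t_def using F by auto
  then obtain p where p: "p \<in> F" "f p = t" using surj by (metis imageE)
  have px: "restrict p (P x) = restrict g (P x)"
    using fun_cong[OF p(2), of x] by (simp add: f_def t_def)
  have py: "restrict p (P y) = restrict \<one>\<^bsub>Aut V E\<^esub> (P y)"
    using fun_cong[OF p(2), of y] ne by (simp add: f_def t_def)
  show ?thesis
  proof (rule that[of p])
    show "p \<in> G" using p(1) by (simp add: F_def pointwise_stabiliser_def)
    fix z assume z: "z \<in> V"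
    show "p z = g z" if "d z x < d z y"
    proof -
      have "z \<in> P x" using closest_edge[OF e z] that z by (simp add: P_def closest_fibre_def)
      then show ?thesis using fun_cong[OF px, of z] by simp
    qed
    show "p z = z" if "\<not> d z x < d z y"
    proof -
      have "z \<in> P y" using closest_edge[OF e z] that z by (simp add: P_def closest_fibre_def)
      then show ?thesis using fun_cong[OF py, of z] one_apply[OF z] by simp
    qed
  qed
qed

text \<open>If \<open>G\<^bsub>v\<^esub>\<close> acted regularly on the neighbours of \<open>v\<close>, the vertices of the other type could be
  labelled by the neighbours of \<open>v\<close>, compatibly with \<open>G\<close> around each vertex of the orbit of \<open>v\<close>. The
  elements preserving the labels would form a proper subgroup containing the stabilisers of all
  labelled vertices.\<close>

lemma no_regular_local_action:
  assumes LT: "\<And>v. v \<in> V \<Longrightarrow> locally_transitive v" and v: "v \<in> V"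
    and reg: "\<And>g a b. g \<in> G \<Longrightarrow> g v = v \<Longrightarrow> {v, a} \<in> E \<Longrightarrow> {v, b} \<in> E \<Longrightarrow> g a = a \<Longrightarrow> g b = b"
  shows False
proof -
  obtain h :: "'a \<Rightarrow> bool" where "\<And>x y. {x, y} \<in> E \<Longrightarrow> (h x \<noteq> h y) = ({x, y} \<in> E)"
    and hG: "\<And>g x. g \<in> G \<Longrightarrow> x \<in> V \<Longrightarrow> h (g x) = h x"
    using parity_colouring[of E] edge_image by blast
  then have h: "h x \<noteq> h y" if "{x, y} \<in> E" for x y using that by blast
  \<comment> \<open>At a vertex \<open>y\<close> of the type of \<open>v\<close>, \<open>L y\<close>
    is an element carrying \<open>y\<close> to \<open>v\<close> and respecting the label already
    given to its parent. At the other type \<open>L\<close> is inherited from the parent, and the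
    label of \<open>u\<close> is \<open>L u u\<close>.\<close>
  define step where "step x y g = (if h y = h v then SOME k. k \<in> G \<and> k y = v \<and> k x = g x else g)"
    for x y and g :: "'a \<Rightarrow> 'a"
  obtain L where L0: "L v = \<one>\<^bsub>Aut V E\<^esub>"
    and L: "\<And>x y. {x, y} \<in> E \<Longrightarrow> d v y = Suc (d v x) \<Longrightarrow> L y = step x y (L x)"
    using tree_recursion[OF v, of "\<one>\<^bsub>Aut V E\<^esub>" step] by metis
  have ex: "\<exists>k. k \<in> G \<and> k y = v \<and> k x = g x"
    if xy: "{x, y} \<in> E" and hy: "h y = h v" and gx: "{v, g x} \<in> E" for x y and g :: "'a \<Rightarrow> 'a"
  proof -
    have V: "x \<in> V" "y \<in> V" using adj_in[OF xy] by auto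
    have "\<exists>k\<in>G. k y = v"
      by (intro same_type[of h]) (simp_all add: LT h hG v V hy)
    then obtain k where k: "k \<in> G" "k y = v" by blast
    have "{v, k x} \<in> E" using G_adjI[OF k(1) xy] k(2) by (simp add: insert_commute)
    then obtain l where l: "l \<in> G" "l v = v" "l (k x) = g x"
      using locally_transitiveD[OF LT[OF v] _ gx] by blast
    then show ?thesis using k V G_mult[OF l(1) k(1)] G_mult_apply[OF l(1) k(1)]
      by (intro exI[of _ "l \<otimes>\<^bsub>Aut V E\<^esub> k"]) simp
  qed
  have stepE: "step x y g \<in> G \<and> step x y g y = v \<and> step x y g x = g x"
    if "{x, y} \<in> E" "h y = h v" "{v, g x} \<in> E" for x y g
    using someI_ex[OF ex[where g = g, OF that]] that(2) by (simp add: step_def)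
  have inv: "L x \<in> G \<and> (if h x = h v then L x x = v else {v, L x x} \<in> E)" if "x \<in> V" for x
    using v that
  proof (induction rule: tree_induct)
    case root
    then show ?case using G_one one_apply v by (simp add: L0)
  next
    case (step x y)
    show ?case
    proof (cases "h y = h v")
      case True
      then have "{v, L x x} \<in> E" using step(3) h[OF step(1)] by simp
      from stepE[where g = "L x", OF step(1) True this] show ?thesis using L[OF step(1,2)] True by simp
    next
      case False
      then have "h x = h v" using h[OF step(1)] by auto
      then have Lx: "L x \<in> G" "L x x = v" using step(3) by auto
      then have "{v, L x y} \<in> E" using G_adjI[OF Lx(1) step(1)] by simp
      moreover have "L y = L x" using L[OF step(1,2)] False by (simp add: step_def)
      ultimately show ?thesis using Lx False by simp
    qed
  qed
  \<comment> \<open>Whether \<open>u\<close> is the parent or a child of \<open>m\<close>, its label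
    is its image under \<open>L m\<close>.\<close>
  have compat: "L m u = L u u" if mu: "{m, u} \<in> E" and hm: "h m = h v" for m u
  proof -
    have um: "{u, m} \<in> E" using mu by (simp add: insert_commute)
    have hu: "h u \<noteq> h v" using h[OF mu] hm by simp
    from adj_dist[OF mu v] show ?thesis
    proof
      assume "d v u = Suc (d v m)"
      then show ?thesis using L[OF mu] hu by (simp add: step_def)
    next
      assume dm: "d v m = Suc (d v u)"
      have "{v, L u u} \<in> E" using inv[of u] adj_in[OF mu] hu by simp
      from stepE[where g = "L u", OF um hm this] show ?thesis using L[OF um dm] by simp
    qed
  qed
  define M where "M = {g \<in> G. \<forall>u\<in>V. h u \<noteq> h v \<longrightarrow> L (g u) (g u) = L u u}"
  obtain a where a: "{v, a} \<in> E" using third_nbr[OF v] by metis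
  obtain b where b: "{v, b} \<in> E" "b \<noteq> a" using third_nbr[OF v] by metis
  have aV: "a \<in> V" using adj_in[OF a] by simp
  have "M = G"
  proof (rule subgroup_containing_stabilisers[OF _ _ aV])
    show "M \<subseteq> G" by (auto simp: M_def)
    show "subgroup M (Aut V E)"
    proof (rule G_subgroupI)
      fix g assume "g \<in> M"
      then have g: "g \<in> G" "\<And>u. u \<in> V \<Longrightarrow> h u \<noteq> h v \<Longrightarrow> L (g u) (g u) = L u u" by (auto simp: M_def)
      have "L ((inv\<^bsub>Aut V E\<^esub> g) u) ((inv\<^bsub>Aut V E\<^esub> g) u) = L u u" if u: "u \<in> V" "h u \<noteq> h v" for u
        using g(2)[of "(inv\<^bsub>Aut V E\<^esub> g) u"] G_in[OF G_inv[OF g(1)] u(1)] hG[OF G_inv[OF g(1)] u(1)]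
          G_inv_apply[OF g(1) u(1)] u(2) by simp
      then show "inv\<^bsub>Aut V E\<^esub> g \<in> M" using g(1) by (simp add: M_def G_inv)
    qed (auto simp: M_def G_one one_apply G_mult G_mult_apply G_in hG)
    fix k g assume k: "k \<in> G" and g: "g \<in> G" "g (k a) = k a"
    have kaV: "k a \<in> V" using k aV G_in by blast
    have hka: "h (k a) \<noteq> h v" using hG[OF k aV] h[OF a] by simp
    have "if h x = h v then \<forall>u. {x, u} \<in> E \<longrightarrow> L (g u) (g u) = L u u else L (g x) (g x) = L x x"
      if "x \<in> V" for x
      using kaV that
    proof (induction rule: tree_induct)
      case root
      then show ?case using g(2) hka by simp
    next
      case (step x y)
      show ?case
      proof (cases "h y = h v")
        case True
        then have Lx: "L (g x) (g x) = L x x" using step(3) h[OF step(1)] by simp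
        have yx: "{y, x} \<in> E" using step(1) by (simp add: insert_commute)
        have V: "x \<in> V" "y \<in> V" using adj_in[OF step(1)] by auto
        have gyV: "g y \<in> V" using g(1) V G_in by blast
        have hgy: "h (g y) = h v" using hG g(1) V True by simp
        have Ly: "L y \<in> G" "L y y = v" using inv[OF V(2)] True by auto
        have Lgy: "L (g y) \<in> G" "L (g y) (g y) = v" using inv[OF gyV] hgy by auto
        \<comment> \<open>\<open>q\<close> is the action of \<open>g\<close> from \<open>y\<close>
          to \<open>g y\<close>, read in the labels. It fixes \<open>v\<close> and the label of
          \<open>x\<close>, hence all labels by regularity.\<close>
        define q where "q = L (g y) \<otimes>\<^bsub>Aut V E\<^esub> (g \<otimes>\<^bsub>Aut V E\<^esub> inv\<^bsub>Aut V E\<^esub> (L y))"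
        have qG: "q \<in> G" unfolding q_def using Lgy(1) g(1) Ly(1) G_mult G_inv by simp
        have q: "q (L y z) = L (g y) (g z)" if z: "z \<in> V" for z
          unfolding q_def using z Lgy(1) g(1) Ly(1)
          by (simp add: G_mult_apply G_mult G_inv G_in G_inv_apply)
        have qv: "q v = v" using q[OF V(2)] Ly(2) Lgy(2) by simp
        have "L (g u) (g u) = L u u" if u: "{y, u} \<in> E" for u
        proof -
          have uV: "u \<in> V" using adj_in[OF u] by simp
          have "{v, L y x} \<in> E" "{v, L y u} \<in> E"
            using G_adjI[OF Ly(1) yx] G_adjI[OF Ly(1) u] Ly(2) by simp_all
          moreover have "q (L y x) = L y x"
            using q[OF V(1)] compat[OF G_adjI[OF g(1) yx] hgy] Lx compat[OF yx True] by simp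
          ultimately have "q (L y u) = L y u" using reg[OF qG qv] by blast
          then show ?thesis
            using q[OF uV] compat[OF G_adjI[OF g(1) u] hgy] compat[OF u True] by simp
        qed
        then show ?thesis using True by simp
      next
        case False
        then have "h x = h v" using h[OF step(1)] by auto
        then show ?thesis using step(1,3) False by simp
      qed
    qed
    then show "g \<in> M" using g(1) by (auto simp: M_def)
  qed
  obtain g where g: "g \<in> G" "g v = v" "g a = b"
    using locally_transitiveD[OF LT[OF v] a b(1)] by blast
  \<comment> \<open>Near the root the labels are the neighbours of \<open>v\<close> themselves, so
    an element moving \<open>a\<close> to \<open>b\<close> changes a label.\<close>
  have "L u u = u" if "{v, u} \<in> E" for u
    using compat[OF that] L0 one_apply adj_in[OF that] by simp
  moreover have "L (g a) (g a) = L a a" using \<open>M = G\<close> g(1) aV h[OF a] unfolding M_def by auto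
  ultimately show False using a b g(3) by simp
qed

text \<open>Having the same stabiliser inside that of \<open>v\<close> is an invariant equivalence
  relation on the neighbours. If it relates two of them, primitivity makes it universal, and the
  local action is regular.\<close>

lemma adjacent_stabilisers_differ:
  assumes LP: "\<And>v. v \<in> V \<Longrightarrow> locally_primitive v" and v: "v \<in> V"
    and u: "{v, u} \<in> E" and u': "{v, u'} \<in> E" and ne: "u \<noteq> u'"
  shows "\<exists>g\<in>G. g v = v \<and> (g u = u) \<noteq> (g u' = u')"
proof (rule ccontr)
  assume "\<not> (\<exists>g\<in>G. g v = v \<and> (g u = u) \<noteq> (g u' = u'))"
  then have eq: "(g u = u) = (g u' = u')" if "g \<in> G" "g v = v" for g using that by blast
  define r where "r = {(a, b). a \<in> nbrs v \<and> b \<in> nbrs v \<and> (\<forall>g\<in>G. g v = v \<longrightarrow> (g a = a) = (g b = b))}"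
  have "equiv (nbrs v) r"
    by (rule equivI) (auto simp: r_def refl_on_def sym_def trans_def)
  moreover have "(k a, k b) \<in> r" if k: "k \<in> G" "k v = v" and ab: "(a, b) \<in> r" for k a b
  proof -
    have N: "a \<in> nbrs v" "b \<in> nbrs v" using ab by (auto simp: r_def)
    have V: "a \<in> V" "b \<in> V" using N adj_in[of v] by auto
    have "(g (k a) = k a) = (g (k b) = k b)" if g: "g \<in> G" "g v = v" for g
    proof -
      let ?c = "inv\<^bsub>Aut V E\<^esub> k \<otimes>\<^bsub>Aut V E\<^esub> (g \<otimes>\<^bsub>Aut V E\<^esub> k)"
      have c: "?c z = (inv\<^bsub>Aut V E\<^esub> k) (g (k z))" if "z \<in> V" for z
        using that k g by (simp add: G_mult_apply G_mult G_inv)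
      have fx: "(?c z = z) = (g (k z) = k z)" if z: "z \<in> V" for z
        using c[OF z] G_inv_apply[OF k(1)] z G_in k(1) g(1) by metis
      have "?c \<in> G" using k g G_mult G_inv by simp
      moreover have "?c v = v" using fx[OF v] k g by simp
      ultimately have "(?c a = a) = (?c b = b)" using ab unfolding r_def by blast
      then show ?thesis using fx V by simp
    qed
    then show ?thesis using nbrs_image[OF k] N by (simp add: r_def del: nbrs_iff)
  qed
  ultimately have "r = Id_on (nbrs v) \<or> r = nbrs v \<times> nbrs v"
    using LP[OF v] unfolding locally_primitive_def by blast
  moreover have "(u, u') \<in> r" using u u' eq by (auto simp: r_def)
  then have "r \<noteq> Id_on (nbrs v)" using ne by auto
  ultimately have r: "r = nbrs v \<times> nbrs v" by blast
  show False
  proof (rule no_regular_local_action[OF _ v])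
    show "locally_transitive x" if "x \<in> V" for x using LP[OF that] by (simp add: locally_primitive_def)
    fix g a b assume g: "g \<in> G" "g v = v" and ab: "{v, a} \<in> E" "{v, b} \<in> E" "g a = a"
    have "(a, b) \<in> r" using ab by (simp add: r)
    then show "g b = b" using g ab(3) unfolding r_def by blast
  qed
qed

text \<open>The elements of \<open>H\<close> fixing \<open>v\<close> move \<open>u\<close> through a
  block. By primitivity the block is \<open>{u}\<close>, or it contains all neighbours; in the
  latter case these elements are transitive and contain a point stabiliser, hence exhaust the
  stabiliser of \<open>v\<close>.\<close>

lemma edge_stabiliser_maximal:
  assumes LP: "\<And>v. v \<in> V \<Longrightarrow> locally_primitive v" and v: "v \<in> V"
    and H: "subgroup H (Aut V E)" "H \<subseteq> G" and u: "{v, u} \<in> E"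
    and stab: "\<And>g. g \<in> G \<Longrightarrow> g v = v \<Longrightarrow> g u = u \<Longrightarrow> g \<in> H"
  shows "(\<forall>k\<in>H. k v = v \<longrightarrow> k u = u) \<or> (\<forall>g\<in>G. g v = v \<longrightarrow> g \<in> H)"
proof -
  have uV: "u \<in> V" using adj_in[OF u] by simp
  note H_mult = subgroup.m_closed[OF H(1)] and H_inv = subgroup.m_inv_closed[OF H(1)]
  have HG: "k \<in> G" if "k \<in> H" for k using H(2) that by blast
  define r where "r = {(x, y). \<exists>g\<in>G. \<exists>k\<in>H. g v = v \<and> k v = v \<and> x = g u \<and> y = g (k u)}"
  have LT: "locally_transitive v" using LP[OF v] by (simp add: locally_primitive_def)
  have rI: "(g u, g (k u)) \<in> r" if "g \<in> G" "k \<in> H" "g v = v" "k v = v" for g k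
    using that unfolding r_def by blast
  have "equiv (nbrs v) r"
  proof (rule equivI)
    show "r \<subseteq> nbrs v \<times> nbrs v"
    proof clarify
      fix x y assume "(x, y) \<in> r"
      then obtain g k where gk: "g \<in> G" "k \<in> H" "g v = v" "k v = v" "x = g u" "y = g (k u)"
        unfolding r_def by blast
      have "u \<in> nbrs v" using u by simp
      then show "x \<in> nbrs v \<and> y \<in> nbrs v" using nbrs_image gk HG by (simp del: nbrs_iff)
    qed
    show "refl_on (nbrs v) r"
      unfolding refl_on_def
    proof
      fix x assume "x \<in> nbrs v"
      then obtain g where g: "g \<in> G" "g v = v" "g u = x" using locally_transitiveD[OF LT u, of x] by auto
      have "\<one>\<^bsub>Aut V E\<^esub> \<in> H" by (rule subgroup.one_closed[OF H(1)])
      from rI[OF g(1) this g(2)] show "(x, x) \<in> r" using g(3) one_apply uV v by simp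
    qed
    show "sym r"
    proof (rule symI)
      fix x y assume "(x, y) \<in> r"
      then obtain g k where gk: "g \<in> G" "k \<in> H" "g v = v" "k v = v" "x = g u" "y = g (k u)"
        unfolding r_def by blast
      have kG: "k \<in> G" using gk HG by blast
      have "((g \<otimes>\<^bsub>Aut V E\<^esub> k) u, (g \<otimes>\<^bsub>Aut V E\<^esub> k) ((inv\<^bsub>Aut V E\<^esub> k) u)) \<in> r"
        using gk kG v by (intro rI G_mult H_inv) (auto simp: G_mult_apply inv_image_eq)
      then show "(y, x) \<in> r"
        using gk kG uV by (simp add: G_mult_apply G_inv_apply G_in G_inv)
    qed
    show "trans r"
    proof (rule transI)
      fix x y z assume "(x, y) \<in> r" "(y, z) \<in> r"
      then obtain g k g' k' where gk: "g \<in> G" "k \<in> H" "g v = v" "k v = v" "x = g u" "y = g (k u)"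
        and gk': "g' \<in> G" "k' \<in> H" "g' v = v" "k' v = v" "y = g' u" "z = g' (k' u)"
        unfolding r_def by blast
      have kG: "k \<in> G" "k' \<in> G" using gk gk' HG by auto
      \<comment> \<open>Both \<open>g k\<close> and \<open>g'\<close> send \<open>u\<close> to
        \<open>y\<close>, so they differ by \<open>?s\<close>, which fixes \<open>v\<close> and
        \<open>u\<close> and thus lies in \<open>H\<close>.\<close>
      let ?s = "inv\<^bsub>Aut V E\<^esub> (g \<otimes>\<^bsub>Aut V E\<^esub> k) \<otimes>\<^bsub>Aut V E\<^esub> g'"
      have gkG: "g \<otimes>\<^bsub>Aut V E\<^esub> k \<in> G" using G_mult gk kG by blast
      have sG: "?s \<in> G" using G_mult G_inv gkG gk' by blast
      have gku: "(g \<otimes>\<^bsub>Aut V E\<^esub> k) u = g' u" "(g \<otimes>\<^bsub>Aut V E\<^esub> k) v = g' v"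
        using gk gk' kG uV v by (auto simp: G_mult_apply)
      have "?s u = u" "?s v = v"
        using coset_fixes[of g' "g \<otimes>\<^bsub>Aut V E\<^esub> k"] gku Gc gkG gk'(1) uV v by auto
      then have sH: "?s \<in> H" using stab[OF sG] by blast
      let ?t = "k \<otimes>\<^bsub>Aut V E\<^esub> (?s \<otimes>\<^bsub>Aut V E\<^esub> k')"
      have tH: "?t \<in> H" using H_mult gk gk' sH by blast
      have tv: "?t v = v" using kG sG \<open>?s v = v\<close> gk gk' v by (simp add: G_mult_apply G_mult G_in)
      have k'u: "k' u \<in> V" using G_in kG uV by blast
      have "g (?t u) = (g \<otimes>\<^bsub>Aut V E\<^esub> k) (?s (k' u))"
        using gk(1) kG sG uV k'u by (simp add: G_mult_apply G_mult G_in)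
      also have "?s (k' u) = (inv\<^bsub>Aut V E\<^esub> (g \<otimes>\<^bsub>Aut V E\<^esub> k)) (g' (k' u))"
        by (rule G_mult_apply[OF G_inv[OF gkG] gk'(1) k'u])
      also have "(g \<otimes>\<^bsub>Aut V E\<^esub> k) \<dots> = g' (k' u)"
        by (rule G_inv_apply(2)[OF gkG]) (use G_in gk'(1) k'u in blast)
      finally have "z = g (?t u)" using gk' by simp
      then show "(x, z) \<in> r" using rI[OF gk(1) tH gk(3) tv] gk(5) by simp
    qed
  qed
  moreover have "(l x, l y) \<in> r" if l: "l \<in> G" "l v = v" and xy: "(x, y) \<in> r" for l x y
  proof -
    obtain g k where gk: "g \<in> G" "k \<in> H" "g v = v" "k v = v" "x = g u" "y = g (k u)"
      using xy unfolding r_def by blast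
    have "((l \<otimes>\<^bsub>Aut V E\<^esub> g) u, (l \<otimes>\<^bsub>Aut V E\<^esub> g) (k u)) \<in> r"
      using gk l v by (intro rI G_mult) (auto simp: G_mult_apply)
    then show ?thesis using gk l uV G_in[OF HG[OF gk(2)] uV] by (simp add: G_mult_apply)
  qed
  ultimately have "r = Id_on (nbrs v) \<or> r = nbrs v \<times> nbrs v"
    using LP[OF v] unfolding locally_primitive_def by blast
  then show ?thesis
  proof
    assume r: "r = Id_on (nbrs v)"
    have "k u = u" if k: "k \<in> H" "k v = v" for k
    proof -
      have "(\<one>\<^bsub>Aut V E\<^esub> u, \<one>\<^bsub>Aut V E\<^esub> (k u)) \<in> r"
        using rI[OF G_one k(1) _ k(2)] one_apply v by simp
      then have "(u, k u) \<in> r" using one_apply uV G_in[OF HG[OF k(1)] uV] by simp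
      then show ?thesis using r by auto
    qed
    then show ?thesis by blast
  next
    assume r: "r = nbrs v \<times> nbrs v"
    have "l \<in> H" if l: "l \<in> G" "l v = v" for l
    proof -
      have "(u, l u) \<in> r" using r u nbrs_image[OF l, of u] by simp
      then obtain g k where gk: "g \<in> G" "k \<in> H" "g v = v" "k v = v" "u = g u" "l u = g (k u)"
        unfolding r_def by blast
      have gH: "g \<in> H" using stab gk by metis
      have gkH: "g \<otimes>\<^bsub>Aut V E\<^esub> k \<in> H" using H_mult gH gk(2) .
      have eq: "l u = (g \<otimes>\<^bsub>Aut V E\<^esub> k) u" "l v = (g \<otimes>\<^bsub>Aut V E\<^esub> k) v"
        using gk l uV v HG by (auto simp: G_mult_apply)
      let ?s = "inv\<^bsub>Aut V E\<^esub> (g \<otimes>\<^bsub>Aut V E\<^esub> k) \<otimes>\<^bsub>Aut V E\<^esub> l"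
      have "?s \<in> G" using G_mult G_inv HG gkH l(1) by blast
      moreover have "?s u = u" "?s v = v"
        using coset_fixes[OF Gc[OF l(1)] Gc[OF HG[OF gkH]]] eq uV v by auto
      ultimately have "?s \<in> H" using stab by blast
      then have "(g \<otimes>\<^bsub>Aut V E\<^esub> k) \<otimes>\<^bsub>Aut V E\<^esub> ?s \<in> H" by (rule H_mult[OF gkH])
      then show ?thesis using Gc[OF l(1)] Gc[OF HG[OF gkH]] by (simp add: A.m_assoc[symmetric])
    qed
    then show ?thesis by blast
  qed
qed

text \<open>If \<open>H\<close> missed part of the stabiliser of \<open>v\<close>, maximality would
  force its elements fixing \<open>v\<close> to fix both \<open>u\<close> and \<open>u'\<close>; the
  two edge stabilisers would coincide.\<close>

lemma two_edges_generate:
  assumes LP: "\<And>v. v \<in> V \<Longrightarrow> locally_primitive v" and v: "v \<in> V"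
    and H: "subgroup H (Aut V E)" "H \<subseteq> G" and u: "{v, u} \<in> E" "{v, u'} \<in> E" "u \<noteq> u'"
    and stab: "\<And>g. g \<in> G \<Longrightarrow> g v = v \<Longrightarrow> g u = u \<Longrightarrow> g \<in> H"
    and stab': "\<And>g. g \<in> G \<Longrightarrow> g v = v \<Longrightarrow> g u' = u' \<Longrightarrow> g \<in> H"
    and g: "g \<in> G" "g v = v"
  shows "g \<in> H"
proof (rule ccontr)
  assume "g \<notin> H"
  then have "k u = u" "k u' = u'" if "k \<in> H" "k v = v" for k
    using edge_stabiliser_maximal[OF LP v H u(1) stab] edge_stabiliser_maximal[OF LP v H u(2) stab'] g that
    by blast+
  moreover obtain l where "l \<in> G" "l v = v" "(l u = u) \<noteq> (l u' = u')"
    using adjacent_stabilisers_differ[OF LP v u] by blast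
  ultimately show False using stab stab' by blast
qed

text \<open>An element fixing \<open>y\<close> and sending \<open>x\<close> to \<open>z\<close> lies
  in \<open>H\<close> and conjugates the stabiliser of \<open>x\<close> to that of
  \<open>z\<close>.\<close>

lemma stabiliser_spread:
  assumes LT: "locally_transitive y" and H: "subgroup H (Aut V E)" "H \<subseteq> G"
    and xy: "{x, y} \<in> E" and yz: "{y, z} \<in> E"
    and x: "\<And>g. g \<in> G \<Longrightarrow> g x = x \<Longrightarrow> g \<in> H" and y: "\<And>g. g \<in> G \<Longrightarrow> g y = y \<Longrightarrow> g \<in> H"
    and g: "g \<in> G" "g z = z"
  shows "g \<in> H"
proof -
  have V: "x \<in> V" "z \<in> V" using adj_in[OF xy] adj_in[OF yz] by auto
  have "{y, x} \<in> E" using xy by (simp add: insert_commute)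
  then obtain k where k: "k \<in> G" "k y = y" "k x = z" using locally_transitiveD[OF LT _ yz] by blast
  have kH: "k \<in> H" using y k by blast
  let ?c = "inv\<^bsub>Aut V E\<^esub> k \<otimes>\<^bsub>Aut V E\<^esub> (g \<otimes>\<^bsub>Aut V E\<^esub> k)"
  have "?c x = x"
    using k g V by (simp add: G_mult_apply G_mult G_inv inv_image_eq)
  moreover have "?c \<in> G" using k g G_mult G_inv by simp
  ultimately have "?c \<in> H" using x by blast
  then have "k \<otimes>\<^bsub>Aut V E\<^esub> ?c \<otimes>\<^bsub>Aut V E\<^esub> inv\<^bsub>Aut V E\<^esub> k \<in> H"
    using kH subgroup.m_closed[OF H(1)] subgroup.m_inv_closed[OF H(1)] by blast
  moreover have "k \<otimes>\<^bsub>Aut V E\<^esub> ?c \<otimes>\<^bsub>Aut V E\<^esub> inv\<^bsub>Aut V E\<^esub> k = g"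
  proof -
    have "k \<otimes>\<^bsub>Aut V E\<^esub> ?c = g \<otimes>\<^bsub>Aut V E\<^esub> k"
      using Gc k(1) g(1) by (simp add: A.m_assoc[symmetric])
    then show ?thesis using Gc k(1) g(1) by (simp add: A.m_assoc)
  qed
  ultimately show ?thesis by simp
qed

text \<open>The finite set \<open>F\<close>, whose fixator lies in \<open>H\<close>, and its translate \<open>h ` F\<close> are separated by the
  edge \<open>{x, y}\<close>; by Tits' property \<open>G\<^bsub>{x, y}\<^esub>\<close> is the product of the fixators of the two half-trees.\<close>

lemma separating_edge_stabiliser:
  assumes H: "subgroup H (Aut V E)" "H \<subseteq> G" and F: "F \<subseteq> V"
    and fixF: "\<And>g. g \<in> G \<Longrightarrow> (\<forall>a\<in>F. g a = a) \<Longrightarrow> g \<in> H"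
    and h: "h \<in> H" and v: "v \<in> V" and R: "\<And>a. a \<in> F \<Longrightarrow> d v a \<le> R"
    and e: "{x, y} \<in> E" and vxy: "R \<le> d v x" "d v x < d v y"
    and wxy: "R \<le> d (h v) y" "d (h v) y < d (h v) x"
    and g: "g \<in> G" "g x = x" "g y = y"
  shows "g \<in> H"
proof -
  have hG: "h \<in> G" using H(2) h by blast
  have hv: "h v \<in> V" using G_in[OF hG v] .
  have e': "{y, x} \<in> E" using e by (simp add: insert_commute)
  have near: "d a x < d a y" if a: "a \<in> F" for a
  proof (rule ccontr)
    assume "\<not> d a x < d a y"
    then have "d v x + 1 + d y a \<le> d v a" using dist_across[OF e v] a F vxy(2) by blast
    then show False using R[OF a] vxy(1) by simp
  qed
  have far: "\<not> d (h a) x < d (h a) y" if a: "a \<in> F" for a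
  proof
    assume "d (h a) x < d (h a) y"
    moreover have "h a \<in> V" using G_in[OF hG] a F by blast
    ultimately have "d (h v) y + 1 + d x (h a) \<le> d (h v) (h a)"
      using dist_across[OF e' hv _ wxy(2)] by simp
    moreover have "d (h v) (h a) = d v a" using G_d[OF hG v] a F by blast
    ultimately show False using R[OF a] wxy(1) by simp
  qed
  obtain p where p: "p \<in> G" "\<And>z. z \<in> V \<Longrightarrow> d z x < d z y \<Longrightarrow> p z = g z"
    "\<And>z. z \<in> V \<Longrightarrow> \<not> d z x < d z y \<Longrightarrow> p z = z" using tits_edge[OF e g] by blast
  \<comment> \<open>\<open>p\<close> fixes \<open>h\<close> applied to \<open>F\<close> pointwise,
    so its conjugate \<open>?c\<close> fixes \<open>F\<close> and \<open>p\<close> lies in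
    \<open>H\<close>. Since \<open>p\<close> and \<open>g\<close> agree on \<open>F\<close>,
    \<open>g\<close> follows.\<close>
  let ?c = "inv\<^bsub>Aut V E\<^esub> h \<otimes>\<^bsub>Aut V E\<^esub> (p \<otimes>\<^bsub>Aut V E\<^esub> h)"
  have "?c a = a" if a: "a \<in> F" for a
  proof -
    have aV: "a \<in> V" using a F by blast
    then have "p (h a) = h a" using p(3) far[OF a] G_in[OF hG] by blast
    then show ?thesis using aV hG p(1) by (simp add: G_mult_apply G_mult G_inv G_inv_apply)
  qed
  moreover have "?c \<in> G" using hG p(1) G_mult G_inv by simp
  ultimately have "?c \<in> H" using fixF by blast
  then have "h \<otimes>\<^bsub>Aut V E\<^esub> ?c \<otimes>\<^bsub>Aut V E\<^esub> inv\<^bsub>Aut V E\<^esub> h \<in> H"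
    using h subgroup.m_closed[OF H(1)] subgroup.m_inv_closed[OF H(1)] by blast
  moreover have "h \<otimes>\<^bsub>Aut V E\<^esub> ?c \<otimes>\<^bsub>Aut V E\<^esub> inv\<^bsub>Aut V E\<^esub> h = p"
  proof -
    have "h \<otimes>\<^bsub>Aut V E\<^esub> ?c = p \<otimes>\<^bsub>Aut V E\<^esub> h"
      using Gc hG p(1) by (simp add: A.m_assoc[symmetric])
    then show ?thesis using Gc hG p(1) by (simp add: A.m_assoc)
  qed
  ultimately have pH: "p \<in> H" by simp
  have "(inv\<^bsub>Aut V E\<^esub> p \<otimes>\<^bsub>Aut V E\<^esub> g) a = a" if a: "a \<in> F" for a
  proof -
    have aV: "a \<in> V" using a F by blast
    show ?thesis using coset_fixes[OF Gc[OF g(1)] Gc[OF p(1)] aV] p(2)[OF aV near[OF a]] by simp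
  qed
  then have "inv\<^bsub>Aut V E\<^esub> p \<otimes>\<^bsub>Aut V E\<^esub> g \<in> H" using fixF G_mult[OF G_inv[OF p(1)] g(1)] by blast
  then have "p \<otimes>\<^bsub>Aut V E\<^esub> (inv\<^bsub>Aut V E\<^esub> p \<otimes>\<^bsub>Aut V E\<^esub> g) \<in> H"
    by (rule subgroup.m_closed[OF H(1) pH])
  then show ?thesis using Gc p(1) g(1) by (simp add: A.m_assoc[symmetric])
qed

lemma unbounded_open_subgroup:
  assumes LP: "\<And>v. v \<in> V \<Longrightarrow> locally_primitive v"
    and H: "subgroup H (Aut V E)" "H \<subseteq> G" and opn: "openin (subtopology (perm_top V E) G) H"
    and v: "v \<in> V" and unb: "\<And>n. \<exists>h\<in>H. n \<le> d v (h v)"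
  shows "H = G"
proof -
  have LT: "locally_transitive x" if "x \<in> V" for x using LP[OF that] by (simp add: locally_primitive_def)
  obtain F where F: "finite F" "F \<subseteq> V" "\<And>g. g \<in> G \<Longrightarrow> (\<forall>a\<in>F. g a = a) \<Longrightarrow> g \<in> H"
    using open_subgroup_stab[OF H(1) opn] by blast
  obtain R where R: "\<And>a. a \<in> F \<Longrightarrow> d v a \<le> R"
    using finite_imageI[OF F(1), of "d v"] by (meson finite_nat_set_iff_bounded_le image_eqI)
  \<comment> \<open>The bound leaves a margin \<open>R\<close> at each end of the geodesic and three
    edges in between.\<close>
  obtain h where h: "h \<in> H" "2 * R + 3 \<le> d v (h v)" using unb by blast
  define w where "w = h v"
  have w: "w \<in> V" using G_in H(2) h(1) v unfolding w_def by blast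
  have n: "2 * R + 3 \<le> d v w" using h(2) by (simp add: w_def)
  have nw: "z \<noteq> w" if "z \<in> V" "d v z < d v w" for z using that by auto
  obtain x0 where x0: "x0 \<in> V" "d v x0 = R" "d v x0 + d w x0 = d v w"
    using geodesic_point[OF v w, of R] n by auto
  obtain x1 where x1: "{x0, x1} \<in> E" "d v x1 = Suc (d v x0)" "d w x0 = Suc (d w x1)" "d v x1 + d w x1 = d v w"
    using geodesic_succ[OF v w x0(1,3) nw[OF x0(1)]] x0 n by auto
  have x1V: "x1 \<in> V" using adj_in[OF x1(1)] by simp
  obtain x2 where x2: "{x1, x2} \<in> E" "d v x2 = Suc (d v x1)" "d w x1 = Suc (d w x2)" "d v x2 + d w x2 = d v w"
    using geodesic_succ[OF v w x1V x1(4) nw[OF x1V]] x0 x1 n by auto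
  have x2V: "x2 \<in> V" using adj_in[OF x2(1)] by simp
  obtain x3 where x3: "{x2, x3} \<in> E" "d v x3 = Suc (d v x2)" "d w x2 = Suc (d w x3)" "d v x3 + d w x3 = d v w"
    using geodesic_succ[OF v w x2V x2(4) nw[OF x2V]] x0 x1 x2 n by auto
  have sep: "g \<in> H" if "{x, y} \<in> E" "R \<le> d v x" "d v x < d v y" "R \<le> d w y" "d w y < d w x"
    "g \<in> G" "g x = x" "g y = y" for x y g
    using separating_edge_stabiliser[OF H F(2,3) h(1) v R] that unfolding w_def by blast
  have e01: "g \<in> H" if "g \<in> G" "g x0 = x0" "g x1 = x1" for g
    using sep[OF x1(1) _ _ _ _ that] x0 x1 x2 x3 n by simp
  have e12: "g \<in> H" if "g \<in> G" "g x1 = x1" "g x2 = x2" for g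
    using sep[OF x2(1) _ _ _ _ that] x0 x1 x2 x3 n by simp
  have e23: "g \<in> H" if "g \<in> G" "g x2 = x2" "g x3 = x3" for g
    using sep[OF x3(1) _ _ _ _ that] x0 x1 x2 x3 n by simp
  have "{x1, x0} \<in> E" "x0 \<noteq> x2" using x1 x2 by (auto simp: insert_commute)
  then have s1: "g \<in> H" if "g \<in> G" "g x1 = x1" for g
    using two_edges_generate[OF LP x1V H _ x2(1)] e01 e12 that by blast
  have "{x2, x1} \<in> E" "x1 \<noteq> x3" using x2 x3 by (auto simp: insert_commute)
  then have s2: "g \<in> H" if "g \<in> G" "g x2 = x2" for g
    using two_edges_generate[OF LP x2V H _ x3(1)] e12 e23 that by blast
  \<comment> \<open>The claim includes the neighbours of \<open>x\<close>, because spreading to the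
    next vertex requires the stabilisers of both ends of an edge.\<close>
  have all: "(\<forall>g\<in>G. g x = x \<longrightarrow> g \<in> H) \<and> (\<forall>z. {x, z} \<in> E \<longrightarrow> (\<forall>g\<in>G. g z = z \<longrightarrow> g \<in> H))" if "x \<in> V" for x
    using x1V that
  proof (induction rule: tree_induct)
    case root
    have "{x2, x1} \<in> E" using x2(1) by (simp add: insert_commute)
    then show ?case using stabiliser_spread[OF LT[OF x1V] H _ _ s2 s1] s1 by blast
  next
    case (step x y)
    have "locally_transitive y" using LT adj_in[OF step(1)] by blast
    moreover have "g \<in> H" if "g \<in> G" "g x = x" for g using step(3) that by blast
    moreover have y: "g \<in> H" if "g \<in> G" "g y = y" for g using step(1,3) that by blast
    ultimately have "g \<in> H" if "{y, z} \<in> E" "g \<in> G" "g z = z" for z g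
      using stabiliser_spread[of y H x z g] H step(1) that by blast
    then show ?case using y by blast
  qed
  show ?thesis
    by (rule subgroup_containing_stabilisers[OF H v]) (use all G_in[OF _ v] in blast)
qed

text \<open>A proper open subgroup moves \<open>v\<close> by a bounded amount, so its orbits lie in
  balls, which are finite by local finiteness.\<close>

lemma locally_primitive_imp_compact:
  assumes LP: "\<And>v. v \<in> V \<Longrightarrow> locally_primitive v"
  shows proper_open_compact
  unfolding proper_open_compact_def
proof (intro allI impI)
  fix H assume H: "subgroup H ((Aut V E)\<lparr>carrier := G\<rparr>) \<and>
      openin (subtopology (perm_top V E) G) H \<and> H \<noteq> G"
  have sub: "subgroup H (Aut V E)" using A.incl_subgroup[OF G] H by blast
  have HG: "H \<subseteq> G" using subgroup.subset[of H "(Aut V E)\<lparr>carrier := G\<rparr>"] H by simp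
  obtain v where v: "v \<in> V" using V_nonempty by blast
  obtain n where n: "\<And>h. h \<in> H \<Longrightarrow> d v (h v) < n"
    using unbounded_open_subgroup[OF LP sub HG _ v] H by (meson not_le)
  have "finite ((\<lambda>h. h x) ` H)" if x: "x \<in> V" for x
  proof -
    have "(\<lambda>h. h x) ` H \<subseteq> {z \<in> V. d v z \<le> n + d v x}"
    proof clarify
      fix h assume h: "h \<in> H"
      then have hG: "h \<in> G" using HG by blast
      have "d v (h x) \<le> d v (h v) + d (h v) (h x)"
        by (rule d_triangle) (use v x G_in[OF hG] in auto)
      then show "h x \<in> V \<and> d v (h x) \<le> n + d v x"
        using n[OF h] G_d[OF hG v x] G_in[OF hG x] by simp
    qed
    then show ?thesis using finite_ball[OF v] finite_subset by blast
  qed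
  then have "compactin (perm_top V E) H"
    using finite_orbits_imp_compact[OF sub closed_open_subgroup[OF sub HG _ closed]] H by blast
  then show "compactin (subtopology (perm_top V E) G) H" using HG by (simp add: compactin_subtopology)
qed

end

section \<open>The equivalence and edge-transitivity\<close>

theorem theorem1:
  fixes V :: "'v set" and E :: "'v set set" and G :: "('v \<Rightarrow> 'v) set"
  assumes "tree V E"
    and "locally_finite V E"
    and "\<forall>v\<in>V. 3 \<le> valence E v"
    and "subgroup G (Aut V E)"
    and "closedin (perm_top V E) G"
    and "class_S ((Aut V E)\<lparr>carrier := G\<rparr>) (subtopology (perm_top V E) G)"
    and "compactly_generated ((Aut V E)\<lparr>carrier := G\<rparr>) (subtopology (perm_top V E) G)"
    and "\<nexists>V' E'. subtree V' E' V E \<and> (V', E') \<noteq> (V, E) \<and>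
           (\<forall>g\<in>G. g ` V' = V' \<and> (\<lambda>e. g ` e) ` E' = E')"
    and "tits_independence V E G"
  shows "((\<forall>H. subgroup H ((Aut V E)\<lparr>carrier := G\<rparr>) \<and>
              openin (subtopology (perm_top V E) G) H \<and> H \<noteq> G \<longrightarrow>
              compactin (subtopology (perm_top V E) G) H)
          \<longleftrightarrow> (\<forall>v\<in>V. primitive_action ((Aut V E)\<lparr>carrier := {g \<in> G. g v = v}\<rparr>)
                  (edges_at E v) (edge_action (edges_at E v))))
       \<and> ((\<forall>v\<in>V. primitive_action ((Aut V E)\<lparr>carrier := {g \<in> G. g v = v}\<rparr>)
                  (edges_at E v) (edge_action (edges_at E v)))
          \<longrightarrow> transitive_action ((Aut V E)\<lparr>carrier := G\<rparr>) E (edge_action E))"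
proof -
  interpret tits_tree_action V E G
  proof (intro tits_tree_action.intro loc_finite_tree.intro tree_graph.intro
      simple_tree_action.intro tree_action.intro loc_finite_tree_axioms.intro
      tree_action_axioms.intro simple_tree_action_axioms.intro tits_tree_action_axioms.intro)
    show "topologically_simple ((Aut V E)\<lparr>carrier := G\<rparr>) (subtopology (perm_top V E) G)"
      "subtopology (perm_top V E) G \<noteq> discrete_topology G"
      using assms(6) by (simp_all add: class_S_def)
  qed (use assms(1-5,7-9) in simp_all)
  have prim: "(\<forall>v\<in>V. primitive_action ((Aut V E)\<lparr>carrier := {g \<in> G. g v = v}\<rparr>)
      (edges_at E v) (edge_action (edges_at E v))) \<longleftrightarrow> (\<forall>v\<in>V. locally_primitive v)"
    using primitive_action_iff by simp
  have "proper_open_compact \<longleftrightarrow> (\<forall>v\<in>V. locally_primitive v)"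
    using compact_imp_locally_primitive locally_primitive_imp_compact by blast
  moreover have "transitive_action ((Aut V E)\<lparr>carrier := G\<rparr>) E (edge_action E)"
    if LP: "\<forall>v\<in>V. locally_primitive v"
  proof -
    have LT: "locally_transitive v" if "v \<in> V" for v
      using LP that by (simp add: locally_primitive_def)
    have "group_action ((Aut V E)\<lparr>carrier := G\<rparr>) E (edge_action E)"
      by (rule group_action_edges[OF G]) (use assms(1) edge_image in \<open>auto simp: tree_def\<close>)
    moreover have "\<exists>g\<in>G. edge_action E g e = f" if "e \<in> E" "f \<in> E" for e f
      using edge_transitive[OF LT that] that(1) unfolding edge_action_def by (metis restrict_apply')
    ultimately show ?thesis
      by (simp add: transitive_action_def transitive_action_axioms_def)
  qed
  ultimately show ?thesis unfolding prim proper_open_compact_def by blast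
qed

end
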